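(* Let $P,\sigma>0$, let $L\ge2$ be an integer, and let $\mathrm{snr}=P/\sigma^2$. Define $$R_{\mathrm{crit},L-1}(\mathrm{snr})=\frac12\ln\left(\frac12+\frac{\mathrm{snr}}{2L}+\frac12\sqrt{1-\frac{2(L-2)}{L^2}\mathrm{snr}+\frac{\mathrm{snr}^2}{L^2}}\right).$$ For every $0\le R\le\frac12\ln(1+\mathrm{snr})$ there exist codes of rate $R$ for the AWGN channel with input constraint $P$ and noise variance $\sigma^2$ whose error exponent $E_{L-1}(R,\mathrm{snr})=\lim_{n\to\infty}-\frac1n\ln P_{\mathrm{e},\mathrm{avg},L-1}^{\mathrm{ML}}$ under $(L-1)$-list-decoding is bounded as follows. 1. If $R_{\mathrm{crit},L-1}(\mathrm{snr})\le R\le\frac12\ln(1+\mathrm{snr})$, then $$E_{L-1}(R,\mathrm{snr})\ge\frac12\ln\left[e^{2R}-\frac{\mathrm{snr}(e^{2R}-1)}{2}\left(\sqrt{1+\frac{4e^{2R}}{\mathrm{snr}(e^{2R}-1)}}-1\right)\right]+\frac{\mathrm{snr}}{4e^{2R}}\left(e^{2R}+1-(e^{2R}-1)\sqrt{1+\frac{4e^{2R}}{\mathrm{snr}(e^{2R}-1)}}\right).$$ 2. If $0\le R\le R_{\mathrm{crit},L-1}(\mathrm{snr})$, then $$\begin{aligned}E_{L-1}(R,\mathrm{snr})\ge{}&-R(L-1)+\frac{L-1}{2}\ln\left(L+\mathrm{snr}+\sqrt{(L-\mathrm{snr})^2+4\,\mathrm{snr}}\right)+\frac12\ln\left(L-\mathrm{snr}+\sqrt{(L-\mathrm{snr})^2+4\,\mathrm{snr}}\right)\\&+\frac14\left(L+\mathrm{snr}-\sqrt{(L-\mathrm{snr})^2+4\,\mathrm{snr}}\right)-\frac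 L2\ln(2L).\end{aligned}$$
   Context: The AWGN channel with input constraint $P$ and noise variance $\sigma^2$ maps $x\in\mathbb{R}^n$ with $\|x\|_2\le\sqrt{nP}$ to $x+\mathbf{g}$, $\mathbf{g}\sim\mathcal{N}(0,\sigma^2I_n)$. A code is a finite set $\mathcal{C}=\{x_1,\dots,x_M\}\subset\mathbb{R}^n$ with $\|x_i\|_2\le\sqrt{nP}$ for all $i$; its rate is $\frac1n\ln M$. The maximum-likelihood (ML) $(L-1)$-list-decoder outputs the $L-1$ codewords nearest to the channel output, and an error occurs if the transmitted codeword is not in the list: $$P_{\mathrm{e},L-1}^{\mathrm{ML}}(i,\mathcal{C})=\Pr\left[\exists\text{ distinct } i_1,\dots,i_{L-1}\in\{1,\dots,M\}\setminus\{i\}\ \forall j:\ \|x_{i_j}-(x_i+\mathbf{g})\|_2<\|\mathbf{g}\|_2\right],$$ $P_{\mathrm{e},\mathrm{avg},L-1}^{\mathrm{ML}}(\mathcal{C})=\frac1M\sum_{i=1}^M P_{\mathrm{e},L-1}^{\mathrm{ML}}(i,\mathcal{C})$. "Codes of rate $R$" means a sequence of codes along an increasing sequence of blocklengths $n$ whose rates tend to $R$; limits are along this sequence. *)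

theory Defs
  imports "HOL-Probability.Probability"
begin

text \<open>
  The blocklength varies along a sequence, so a vector of \<open>\<real>\<^sup>n\<close> is an extensional function in
  \<open>{..<n} \<rightarrow>\<^sub>E UNIV\<close>. Being extensional, distinct functions are distinct vectors, so \<open>card\<close> of a
  set of them counts codewords correctly.
\<close>

definition euclid_norm :: "nat \<Rightarrow> (nat \<Rightarrow> real) \<Rightarrow> real" where
  "euclid_norm n x = L2_set x {..<n}"

text \<open>\<open>N(0, \<sigma>\<^sup>2 I\<^sub>n)\<close>; the second parameter of \<open>normal_density\<close> is the standard deviation.\<close>

definition awgn_noise :: "nat \<Rightarrow> real \<Rightarrow> (nat \<Rightarrow> real) measure" where
  "awgn_noise n \<sigma> = (\<Pi>\<^sub>M i\<in>{..<n}. density lborel (\<lambda>t. ennreal (normal_density 0 \<sigma> t)))"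

definition awgn_code :: "real \<Rightarrow> nat \<Rightarrow> (nat \<Rightarrow> real) set \<Rightarrow> bool" where
  "awgn_code P n C \<longleftrightarrow>
     finite C \<and> C \<noteq> {} \<and> C \<subseteq> ({..<n} \<rightarrow>\<^sub>E UNIV) \<and> (\<forall>x\<in>C. euclid_norm n x \<le> sqrt (real n * P))"

definition code_rate :: "nat \<Rightarrow> (nat \<Rightarrow> real) set \<Rightarrow> real" where
  "code_rate n C = ln (real (card C)) / real n"

text \<open>
  List decoding with list size \<open>l\<close>. The list \<open>ys\<close> holds the \<open>l\<close> distinct codewords other than the
  transmitted \<open>x\<close> that are strictly closer to the channel output \<open>x + g\<close> than \<open>x\<close> is.
\<close>

definition ml_list_error :: "nat \<Rightarrow> real \<Rightarrow> nat \<Rightarrow> (nat \<Rightarrow> real) set \<Rightarrow> (nat \<Rightarrow> real) \<Rightarrow> real" where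
  "ml_list_error n \<sigma> l C x =
     measure (awgn_noise n \<sigma>)
       {g \<in> space (awgn_noise n \<sigma>).
          \<exists>ys. length ys = l \<and> distinct ys \<and> set ys \<subseteq> C - {x} \<and>
            (\<forall>y\<in>set ys. euclid_norm n (\<lambda>i. y i - (x i + g i)) < euclid_norm n g)}"

definition ml_list_error_avg :: "nat \<Rightarrow> real \<Rightarrow> nat \<Rightarrow> (nat \<Rightarrow> real) set \<Rightarrow> real" where
  "ml_list_error_avg n \<sigma> l C = (\<Sum>x\<in>C. ml_list_error n \<sigma> l C x) / real (card C)"

definition codes_of_rate ::
    "real \<Rightarrow> real \<Rightarrow> (nat \<Rightarrow> nat) \<Rightarrow> (nat \<Rightarrow> (nat \<Rightarrow> real) set) \<Rightarrow> bool" where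
  "codes_of_rate P R n C \<longleftrightarrow>
     strict_mono n \<and> (\<forall>k. 0 < n k) \<and> (\<forall>k. awgn_code P (n k) (C k)) \<and>
     (\<lambda>k. code_rate (n k) (C k)) \<longlonglongrightarrow> R"

text \<open>
  The limit is required to exist, in the extended reals. Positivity of the error probability makes
  the logarithm meaningful: HOL sets \<open>ln 0 = 0\<close>, and without it codes with at most \<open>l\<close> codewords,
  which never err, would count as codes of rate 0.
\<close>

definition has_list_error_exponent ::
    "real \<Rightarrow> nat \<Rightarrow> (nat \<Rightarrow> nat) \<Rightarrow> (nat \<Rightarrow> (nat \<Rightarrow> real) set) \<Rightarrow> ereal \<Rightarrow> bool" where
  "has_list_error_exponent \<sigma> l n C E \<longleftrightarrow>
     (\<forall>k. 0 < ml_list_error_avg (n k) \<sigma> l (C k)) \<and>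
     (\<lambda>k. ereal (- (1 / real (n k)) * ln (ml_list_error_avg (n k) \<sigma> l (C k)))) \<longlonglongrightarrow> E"

text \<open>In the next three definitions \<open>L\<close> is the parameter of the bound; the list size is \<open>L - 1\<close>.\<close>

definition R_crit :: "nat \<Rightarrow> real \<Rightarrow> real" where
  "R_crit L snr = 1/2 * ln (1/2 + snr / (2 * real L)
     + 1/2 * sqrt (1 - 2 * (real L - 2) / (real L)\<^sup>2 * snr + snr\<^sup>2 / (real L)\<^sup>2))"

definition high_rate_bound :: "real \<Rightarrow> real \<Rightarrow> real" where
  "high_rate_bound R snr =
     1/2 * ln (exp (2*R) - snr * (exp (2*R) - 1) / 2
                 * (sqrt (1 + 4 * exp (2*R) / (snr * (exp (2*R) - 1))) - 1))
     + snr / (4 * exp (2*R))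
       * (exp (2*R) + 1 - (exp (2*R) - 1) * sqrt (1 + 4 * exp (2*R) / (snr * (exp (2*R) - 1))))"

definition low_rate_bound :: "nat \<Rightarrow> real \<Rightarrow> real \<Rightarrow> real" where
  "low_rate_bound L R snr =
     - R * (real L - 1)
     + (real L - 1) / 2 * ln (real L + snr + sqrt ((real L - snr)\<^sup>2 + 4 * snr))
     + 1/2 * ln (real L - snr + sqrt ((real L - snr)\<^sup>2 + 4 * snr))
     + 1/4 * (real L + snr - sqrt ((real L - snr)\<^sup>2 + 4 * snr))
     - real L / 2 * ln (2 * real L)"

end

theory Submission
  imports Defs
begin

text \<open>
  The codes come from Gallager's random-coding argument, adapted to lists. Codewords are drawn
  independently from a Gaussian of variance slightly below \<open>P\<close>, conditioned on a thin shell just inside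
  the sphere of squared radius \<open>n * P\<close>. Fix the transmitted \<open>x\<close> and the noise \<open>g\<close>, and let \<open>q\<close> be the
  probability that one random codeword is closer to \<open>x + g\<close> than \<open>x\<close> is. A list error requires \<open>L - 1\<close> of
  \<open>M\<close> independent codewords to be closer, so its probability is at most
  \<open>min 1 ((M * q) ^ (L - 1)) \<le> (M * q) powr \<rho>\<close> for every \<open>\<rho>\<close> between \<open>0\<close> and \<open>L - 1\<close>. A longer list thus
  raises the upper end of the range of Gallager's parameter \<open>\<rho>\<close> from \<open>1\<close> to \<open>L - 1\<close>, and does nothing
  else.

  The probability \<open>q\<close> is bounded by an exponential moment, with decoding parameter
  \<open>1 / (2 * \<sigma>\<^sup>2 * (1 + \<rho>))\<close> and a tilt \<open>r\<close> that exploits that codewords of the shell have nearly full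
  power. Everything in sight is then a product of one-dimensional Gaussian integrals, evaluated in
  \<open>gaussian_quadratic_integral\<close>; \<open>shell_input_error\<close> collects them, \<open>gaussian_norm_concentration\<close>
  shows that conditioning on the shell costs only a factor \<open>2\<close>, and \<open>random_coding\<close> extracts one good
  codebook with distinct codewords.

  For the optimal tilt the exponent is Gallager's \<open>E\<^sub>0(\<rho>)\<close> (\<open>shell_exponent_optimal_tilt\<close>), so
  \<open>E\<^sub>0(\<rho>) - \<rho> * R\<close> is achieved for all \<open>\<rho>\<close> in the range. The low-rate bound is the value at the end point
  \<open>\<rho> = L - 1\<close> (\<open>low_rate_bound_eq\<close>). The high-rate bound is the value at the stationary point, which is in
  the range exactly between the critical rate and the capacity (\<open>high_rate_bound_eq\<close>). Finally, such
  codes do err with positive probability (\<open>ml_list_error_avg_pos\<close>), and a diagonal argument with a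
  convergent subsequence gives a sequence whose exponent is a limit (\<open>codes_with_exponent\<close>).
\<close>

section \<open>Gaussian integrals of quadratic exponentials\<close>

definition sqnorm :: "nat \<Rightarrow> (nat \<Rightarrow> real) \<Rightarrow> real" where
  "sqnorm n x = (\<Sum>i<n. (x i)\<^sup>2)"

lemma euclid_norm_eq_sqrt: "euclid_norm n x = sqrt (sqnorm n x)"
  by (simp add: euclid_norm_def L2_set_def sqnorm_def)

lemma euclid_norm_less_iff: "euclid_norm n x < euclid_norm n y \<longleftrightarrow> sqnorm n x < sqnorm n y"
  by (simp add: euclid_norm_eq_sqrt)

lemma measurable_sqnorm [measurable]: "sqnorm n \<in> borel_measurable (Pi\<^sub>M {..<n} (\<lambda>_. borel))"
  unfolding sqnorm_def by measurable

lemma prob_space_awgn_noise: "0 < \<sigma> \<Longrightarrow> prob_space (awgn_noise n \<sigma>)"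
  unfolding awgn_noise_def by (intro prob_space_PiM prob_space_normal_density)

lemma sets_awgn_noise [measurable_cong]: "sets (awgn_noise n \<sigma>) = sets (Pi\<^sub>M {..<n} (\<lambda>_. borel))"
  unfolding awgn_noise_def by (intro sets_PiM_cong) auto

lemma space_awgn_noise: "space (awgn_noise n \<sigma>) = {..<n} \<rightarrow>\<^sub>E UNIV"
  unfolding awgn_noise_def by (simp add: space_PiM)

text \<open>
  Completing the square in the Gaussian exponent. All exponential moments below are instances of
  this one integral and its product form: the pairwise error bound (\<open>r\<close> the tilt, \<open>\<gamma>\<close> the decoding
  parameter), the average over the noise (\<open>r\<close> and \<open>\<gamma>\<close> both nonnegative, \<open>y\<close> minus the codeword) and the
  Chernoff bound (\<open>\<gamma> = 0\<close>). The parameter \<open>\<alpha>\<close> is half the precision that remains after tilting.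
\<close>

lemma gaussian_quadratic_integral_1d:
  fixes \<tau> r \<gamma> t :: real
  assumes "0 < \<tau>" and \<alpha>: "\<alpha> = 1 / (2 * \<tau>\<^sup>2) - r" and pos: "0 < \<alpha> + \<gamma>"
  shows "(\<integral>\<^sup>+u. ennreal (exp (r * u\<^sup>2 - \<gamma> * (u - t)\<^sup>2))
            \<partial>density lborel (\<lambda>t. ennreal (normal_density 0 \<tau> t)))
         = ennreal (exp (- (\<alpha> * \<gamma> / (\<alpha> + \<gamma>)) * t\<^sup>2) / sqrt (2 * \<tau>\<^sup>2 * (\<alpha> + \<gamma>)))"
proof -
  define m where "m = \<gamma> * t / (\<alpha> + \<gamma>)"
  define s where "s = 1 / sqrt (2 * (\<alpha> + \<gamma>))"
  define c where "c = exp (- (\<alpha> * \<gamma> / (\<alpha> + \<gamma>)) * t\<^sup>2) / sqrt (2 * \<tau>\<^sup>2 * (\<alpha> + \<gamma>))"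
  have s: "0 < s" and s2: "s\<^sup>2 = 1 / (2 * (\<alpha> + \<gamma>))"
    using pos by (auto simp: s_def power_divide)
  have r: "r = 1 / (2 * \<tau>\<^sup>2) - \<alpha>" using \<alpha> by simp
  have c0: "0 \<le> c" using pos by (simp add: c_def)
  \<comment> \<open>the integrand is a multiple of the normal density with mean \<open>m\<close> and standard deviation \<open>s\<close>\<close>
  have eq: "normal_density 0 \<tau> u * exp (r * u\<^sup>2 - \<gamma> * (u - t)\<^sup>2) = c * normal_density m s u" for u
  proof -
    have e1: "- (u\<^sup>2 / (2 * \<tau>\<^sup>2)) + (r * u\<^sup>2 - \<gamma> * (u - t)\<^sup>2)
              = - (\<alpha> * \<gamma> / (\<alpha> + \<gamma>)) * t\<^sup>2 + - ((\<alpha> + \<gamma>) * (u - m)\<^sup>2)"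
    proof -
      have Dm: "(\<alpha> + \<gamma>) * m = \<gamma> * t" using pos by (simp add: m_def)
      have "(\<alpha> + \<gamma>) * (u - m)\<^sup>2 = (\<alpha> + \<gamma>) * u\<^sup>2 - 2 * u * ((\<alpha> + \<gamma>) * m) + ((\<alpha> + \<gamma>) * m) * m"
        by (simp add: power2_eq_square algebra_simps)
      then have "(\<alpha> + \<gamma>) * (u - m)\<^sup>2 = (\<alpha> + \<gamma>) * u\<^sup>2 - 2 * u * (\<gamma> * t) + (\<gamma> * t) * m"
        unfolding Dm .
      moreover have "\<alpha> * \<gamma> / (\<alpha> + \<gamma>) * t\<^sup>2 + (\<gamma> * t) * m = \<gamma> * t\<^sup>2"
      proof -
        define D where "D = \<alpha> + \<gamma>"
        have "\<alpha> * \<gamma> / D * t\<^sup>2 + (\<gamma> * t) * (\<gamma> * t / D) = (\<alpha> * \<gamma> * t\<^sup>2 + \<gamma> * \<gamma> * t\<^sup>2) / D"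
          by (simp add: power2_eq_square add_divide_distrib mult_ac)
        also have "\<alpha> * \<gamma> * t\<^sup>2 + \<gamma> * \<gamma> * t\<^sup>2 = D * (\<gamma> * t\<^sup>2)"
          by (simp add: D_def algebra_simps)
        finally show ?thesis using pos by (simp add: m_def D_def)
      qed
      ultimately show ?thesis unfolding r by (simp add: power2_eq_square algebra_simps)
    qed
    have e2: "- (u - m)\<^sup>2 / (2 * s\<^sup>2) = - ((\<alpha> + \<gamma>) * (u - m)\<^sup>2)"
      unfolding s2 using pos by (simp add: field_simps)
    have e3: "sqrt (2 * pi * \<tau>\<^sup>2) = sqrt (2 * \<tau>\<^sup>2 * (\<alpha> + \<gamma>)) * sqrt (2 * pi * s\<^sup>2)"
      unfolding real_sqrt_mult [symmetric] s2 using pos by (simp add: field_simps)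
    show ?thesis
      unfolding normal_density_def c_def e2 e3
      using e1 by (simp add: exp_add [symmetric] mult.assoc)
  qed
  interpret N: prob_space "density lborel (normal_density m s)"
    using s by (rule prob_space_normal_density)
  have int1: "(\<integral>\<^sup>+u. ennreal (normal_density m s u) \<partial>lborel) = 1"
    using N.emeasure_space_1 by (simp add: emeasure_density)
  have "(\<integral>\<^sup>+u. ennreal (exp (r * u\<^sup>2 - \<gamma> * (u - t)\<^sup>2)) \<partial>density lborel (\<lambda>t. ennreal (normal_density 0 \<tau> t)))
        = (\<integral>\<^sup>+u. ennreal c * ennreal (normal_density m s u) \<partial>lborel)"
  proof (subst nn_integral_density)
    show "(\<integral>\<^sup>+u. ennreal (normal_density 0 \<tau> u) * ennreal (exp (r * u\<^sup>2 - \<gamma> * (u - t)\<^sup>2)) \<partial>lborel)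
        = (\<integral>\<^sup>+u. ennreal c * ennreal (normal_density m s u) \<partial>lborel)"
      by (simp only: ennreal_mult' [OF normal_density_nonneg, symmetric] ennreal_mult' [OF c0, symmetric] eq)
  qed auto
  also have "\<dots> = ennreal c"
    by (simp add: nn_integral_cmult int1)
  finally show ?thesis by (simp add: c_def)
qed

lemma gaussian_quadratic_integral:
  fixes \<tau> r \<gamma> :: real
  assumes "0 < \<tau>" and \<alpha>: "\<alpha> = 1 / (2 * \<tau>\<^sup>2) - r" and pos: "0 < \<alpha> + \<gamma>"
  shows "(\<integral>\<^sup>+x. ennreal (exp (r * sqnorm n x - \<gamma> * sqnorm n (\<lambda>i. x i - y i))) \<partial>awgn_noise n \<tau>)
         = ennreal (exp (- (\<alpha> * \<gamma> / (\<alpha> + \<gamma>)) * sqnorm n y)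
                    / sqrt (2 * \<tau>\<^sup>2 * (\<alpha> + \<gamma>)) ^ n)"
proof -
  let ?N = "density lborel (\<lambda>t. ennreal (normal_density 0 \<tau> t))"
  interpret N: prob_space ?N using assms(1) by (rule prob_space_normal_density)
  interpret product_sigma_finite "\<lambda>_::nat. ?N"
    by (simp add: product_sigma_finite_def N.sigma_finite_measure_axioms)
  have "(\<integral>\<^sup>+x. ennreal (exp (r * sqnorm n x - \<gamma> * sqnorm n (\<lambda>i. x i - y i))) \<partial>awgn_noise n \<tau>)
      = (\<integral>\<^sup>+x. (\<Prod>i<n. ennreal (exp (r * (x i)\<^sup>2 - \<gamma> * (x i - y i)\<^sup>2))) \<partial>awgn_noise n \<tau>)"
    by (intro nn_integral_cong)
       (simp add: prod_ennreal exp_sum [symmetric] sqnorm_def sum_distrib_left sum_subtractf)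
  also have "\<dots> = (\<Prod>i<n. \<integral>\<^sup>+u. ennreal (exp (r * u\<^sup>2 - \<gamma> * (u - y i)\<^sup>2)) \<partial>?N)"
    unfolding awgn_noise_def by (intro product_nn_integral_prod) auto
  also have "\<dots> = (\<Prod>i<n. ennreal (exp (- (\<alpha> * \<gamma> / (\<alpha> + \<gamma>)) * (y i)\<^sup>2) / sqrt (2 * \<tau>\<^sup>2 * (\<alpha> + \<gamma>))))"
    by (intro prod.cong refl gaussian_quadratic_integral_1d assms)
  also have "\<dots> = ennreal (exp (- (\<alpha> * \<gamma> / (\<alpha> + \<gamma>)) * sqnorm n y) / sqrt (2 * \<tau>\<^sup>2 * (\<alpha> + \<gamma>)) ^ n)"
    using pos by (subst prod_ennreal)
      (auto simp: prod_dividef exp_sum [symmetric] sqnorm_def sum_distrib_left)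
  finally show ?thesis .
qed

section \<open>Concentration of the norm of a Gaussian vector\<close>

lemma gaussian_chernoff:
  assumes "0 < \<tau>" and t: "2 * t * \<tau>\<^sup>2 < 1"
  shows "measure (awgn_noise n \<tau>) {x \<in> space (awgn_noise n \<tau>). real n * a \<le> t * sqnorm n x}
         \<le> (exp (- a) / sqrt (1 - 2 * t * \<tau>\<^sup>2)) ^ n"
proof -
  let ?G = "awgn_noise n \<tau>"
  interpret G: prob_space ?G using assms(1) by (rule prob_space_awgn_noise)
  let ?E = "{x \<in> space ?G. real n * a \<le> t * sqnorm n x}"
  have E: "?E \<in> sets ?G" by measurable
  have \<alpha>: "1 / (2 * \<tau>\<^sup>2) - t = (1 - 2 * t * \<tau>\<^sup>2) / (2 * \<tau>\<^sup>2)" using assms(1) by (simp add: field_simps)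
  have pos: "0 < 1 / (2 * \<tau>\<^sup>2) - t + 0" using t assms(1) unfolding \<alpha> by simp
  have "emeasure ?G ?E = (\<integral>\<^sup>+x. indicator ?E x \<partial>?G)"
    using E by simp
  also have "\<dots> \<le> (\<integral>\<^sup>+x. ennreal (exp (- (real n * a))) * ennreal (exp (t * sqnorm n x - 0 * sqnorm n (\<lambda>i. x i - 0))) \<partial>?G)"
    by (intro nn_integral_mono)
       (auto simp: indicator_def ennreal_mult' [symmetric] exp_add [symmetric] ennreal_1 [symmetric]
         simp del: ennreal_1 intro!: ennreal_leI)
  also have "\<dots> = ennreal (exp (- (real n * a))) * ennreal (1 / sqrt (1 - 2 * t * \<tau>\<^sup>2) ^ n)"
  proof -
    have "2 * \<tau>\<^sup>2 * (1 / (2 * \<tau>\<^sup>2) - t + 0) = 1 - 2 * t * \<tau>\<^sup>2" using assms(1) by (simp add: field_simps)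
    then show ?thesis
      using gaussian_quadratic_integral [OF assms(1) refl pos, of n "\<lambda>_. 0"]
      by (subst nn_integral_cmult) (auto simp: sqnorm_def)
  qed
  also have "\<dots> = ennreal ((exp (- a) / sqrt (1 - 2 * t * \<tau>\<^sup>2)) ^ n)"
    by (simp add: ennreal_mult' [symmetric] power_divide exp_of_nat_mult [symmetric])
  finally show ?thesis using t by (simp add: G.emeasure_eq_measure)
qed

text \<open>
  Conditioning a Gaussian vector on a thin shell must cost only a constant factor. Both tails of the
  squared norm decay geometrically: with \<open>w = 2 * t * \<tau>\<^sup>2\<close>, the logarithm of each Chernoff ratio is at
  most \<open>w\<^sup>2 - t * \<delta>\<close>, by the second-order bounds on \<open>ln (1 - w)\<close> and \<open>ln (1 + w)\<close>, and \<open>w\<close> is chosen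
  so small that \<open>t * \<delta> \<ge> 2 * w\<^sup>2\<close>.
\<close>

lemma gaussian_norm_concentration:
  assumes "0 < \<tau>" "0 < \<delta>"
  shows "\<forall>\<^sub>F n in sequentially. 1/2 \<le> measure (awgn_noise n \<tau>)
    {x \<in> space (awgn_noise n \<tau>). real n * (\<tau>\<^sup>2 - \<delta>) \<le> sqnorm n x \<and> sqnorm n x \<le> real n * (\<tau>\<^sup>2 + \<delta>)}"
proof -
  define w where "w = min (1/4) (\<delta> / (4 * \<tau>\<^sup>2))"
  define t where "t = w / (2 * \<tau>\<^sup>2)"
  have w: "0 < w" "w \<le> 1/4" "w \<le> \<delta> / (4 * \<tau>\<^sup>2)" using assms by (auto simp: w_def)
  have t: "0 < t" "2 * t * \<tau>\<^sup>2 = w" using w assms by (auto simp: t_def)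
  have t\<delta>: "t * \<delta> \<ge> 2 * w\<^sup>2"
  proof -
    have "w * (4 * \<tau>\<^sup>2) \<le> \<delta>" using w(3) assms by (simp add: field_simps)
    then have "t * (w * (4 * \<tau>\<^sup>2)) \<le> t * \<delta>" using t(1) by (intro mult_left_mono) auto
    moreover have "t * (w * (4 * \<tau>\<^sup>2)) = 2 * w * (2 * t * \<tau>\<^sup>2)" by simp
    moreover have "\<dots> = 2 * w\<^sup>2" unfolding t(2) by (simp add: power2_eq_square)
    ultimately show ?thesis by linarith
  qed
  have t\<tau>: "t * \<tau>\<^sup>2 = w / 2" using t(2) by simp
  define K1 where "K1 = exp (- (t * (\<tau>\<^sup>2 + \<delta>))) / sqrt (1 - w)"
  define K2 where "K2 = exp (- (- t * (\<tau>\<^sup>2 - \<delta>))) / sqrt (1 + w)"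
  have half_ln: "sqrt z = exp (ln z / 2)" if "0 < z" for z :: real
    using that by (simp add: powr_half_sqrt [symmetric] powr_def)
  have w2: "0 < w\<^sup>2" using w(1) by simp
  have K1: "0 \<le> K1" "K1 < 1"
  proof -
    have "- w - 2 * w\<^sup>2 \<le> ln (1 - w)" using w by (intro ln_one_minus_pos_lower_bound) auto
    moreover have "t * (\<tau>\<^sup>2 + \<delta>) = w / 2 + t * \<delta>" by (simp add: distrib_left t\<tau>)
    ultimately have "- (t * (\<tau>\<^sup>2 + \<delta>)) < ln (1 - w) / 2" using t\<delta> w2 by linarith
    then show "K1 < 1" unfolding K1_def using w by (simp add: half_ln)
    show "0 \<le> K1" using w by (simp add: K1_def)
  qed
  have K2: "0 \<le> K2" "K2 < 1"
  proof -
    have "w - w\<^sup>2 \<le> ln (1 + w)" using w by (intro ln_one_plus_pos_lower_bound) auto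
    moreover have "- (- t * (\<tau>\<^sup>2 - \<delta>)) = w / 2 - t * \<delta>" by (simp add: right_diff_distrib t\<tau>)
    ultimately have "- (- t * (\<tau>\<^sup>2 - \<delta>)) < ln (1 + w) / 2" using t\<delta> w2 by linarith
    then show "K2 < 1" unfolding K2_def using w by (simp add: half_ln)
    show "0 \<le> K2" using w by (simp add: K2_def)
  qed
  have "(\<lambda>n. K1 ^ n + K2 ^ n) \<longlonglongrightarrow> 0 + 0"
    using K1 K2 by (intro tendsto_add LIMSEQ_realpow_zero) auto
  then have "\<forall>\<^sub>F n in sequentially. K1 ^ n + K2 ^ n < 1/2"
    by (rule order_tendstoD) simp
  then show ?thesis
  proof eventually_elim
    case (elim n)
    let ?G = "awgn_noise n \<tau>"
    interpret G: prob_space ?G using assms(1) by (rule prob_space_awgn_noise)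
    let ?S = "{x \<in> space ?G. real n * (\<tau>\<^sup>2 - \<delta>) \<le> sqnorm n x \<and> sqnorm n x \<le> real n * (\<tau>\<^sup>2 + \<delta>)}"
    let ?U = "{x \<in> space ?G. real n * (t * (\<tau>\<^sup>2 + \<delta>)) \<le> t * sqnorm n x}"
    let ?D = "{x \<in> space ?G. real n * (- t * (\<tau>\<^sup>2 - \<delta>)) \<le> - t * sqnorm n x}"
    have [measurable]: "?S \<in> sets ?G" "?U \<in> sets ?G" "?D \<in> sets ?G" by measurable
    have "?U = {x \<in> space ?G. real n * (\<tau>\<^sup>2 + \<delta>) \<le> sqnorm n x}"
      "?D = {x \<in> space ?G. sqnorm n x \<le> real n * (\<tau>\<^sup>2 - \<delta>)}"
      using t(1) by (simp_all add: mult.left_commute [of _ t])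
    then have "space ?G - ?S \<subseteq> ?U \<union> ?D" by auto
    then have "G.prob (space ?G - ?S) \<le> G.prob (?U \<union> ?D)" by (intro G.finite_measure_mono) auto
    also have "\<dots> \<le> G.prob ?U + G.prob ?D" by (intro measure_Un_le) auto
    also have "\<dots> \<le> K1 ^ n + K2 ^ n"
      using gaussian_chernoff [OF assms(1), of t n "t * (\<tau>\<^sup>2 + \<delta>)"]
        gaussian_chernoff [OF assms(1), of "- t" n "- t * (\<tau>\<^sup>2 - \<delta>)"] w(1,2) t(2)
      by (intro add_mono) (simp_all add: K1_def K2_def)
    finally show ?case using elim by (simp add: G.prob_compl)
  qed
qed

section \<open>Random codebooks under list decoding\<close>

text \<open>
  The union bound over the \<open>l\<close>-element subsets of the competitors; within one subset the events are
  independent.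
\<close>

lemma list_union_bound:
  fixes N :: "'a measure"
  assumes N: "prob_space N" and I: "finite I" and A [measurable]: "A \<in> sets N"
  shows "measure (Pi\<^sub>M I (\<lambda>_. N)) {c \<in> space (Pi\<^sub>M I (\<lambda>_. N)). \<exists>J\<in>{J. J \<subseteq> I \<and> card J = l}. \<forall>j\<in>J. c j \<in> A}
         \<le> (real (card I) * measure N A) ^ l"
proof -
  interpret N: prob_space N by fact
  interpret P: finite_product_prob_space "\<lambda>_. N" I
    by unfold_locales (use I in auto)
  let ?P = "Pi\<^sub>M I (\<lambda>_. N)"
  let ?S = "{J. J \<subseteq> I \<and> card J = l}"
  have fin: "finite ?S" using I by (auto intro: finite_subset [OF _ finite_Pow_iff [THEN iffD2, OF I]])
  have "{c \<in> space ?P. \<forall>j\<in>J. c j \<in> A} = (\<Pi>\<^sub>E i\<in>I. if i \<in> J then A else space N)"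
    if "J \<in> ?S" for J
  proof (intro set_eqI iffI)
    fix c assume c: "c \<in> {c \<in> space ?P. \<forall>j\<in>J. c j \<in> A}"
    then show "c \<in> (\<Pi>\<^sub>E i\<in>I. if i \<in> J then A else space N)"
      unfolding space_PiM PiE_iff by simp
  next
    fix c assume c: "c \<in> (\<Pi>\<^sub>E i\<in>I. if i \<in> J then A else space N)"
    have "c i \<in> space N" if "i \<in> I" for i
      using PiE_mem [OF c that] sets.sets_into_space [OF A] by (auto split: if_splits)
    moreover have "c j \<in> A" if "j \<in> J" for j
    proof -
      have "j \<in> I" using that \<open>J \<in> ?S\<close> by auto
      from PiE_mem [OF c this] that show ?thesis by simp
    qed
    ultimately show "c \<in> {c \<in> space ?P. \<forall>j\<in>J. c j \<in> A}"
      using c unfolding space_PiM PiE_iff by simp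
  qed
  moreover have "P.prob (\<Pi>\<^sub>E i\<in>I. if i \<in> J then A else space N) = measure N A ^ l" if "J \<in> ?S" for J
  proof -
    have "P.prob (\<Pi>\<^sub>E i\<in>I. if i \<in> J then A else space N)
          = (\<Prod>i\<in>I. measure N (if i \<in> J then A else space N))"
      by (intro P.prob_times) auto
    also have "\<dots> = (\<Prod>i\<in>I. if i \<in> J then measure N A else 1)"
      by (intro prod.cong) (auto simp: N.prob_space)
    also have "\<dots> = measure N A ^ l"
      using that I by (simp add: prod.If_cases Int_absorb1)
    finally show ?thesis .
  qed
  ultimately have each: "P.prob {c \<in> space ?P. \<forall>j\<in>J. c j \<in> A} = measure N A ^ l" if "J \<in> ?S" for J
    using that by simp
  have meas: "{c \<in> space ?P. \<forall>j\<in>J. c j \<in> A} \<in> sets ?P" if "J \<in> ?S" for J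
  proof -
    have "finite J" using that I by (auto intro: finite_subset)
    moreover have "j \<in> I" if "j \<in> J" for j using that \<open>J \<in> ?S\<close> by auto
    ultimately show ?thesis by measurable
  qed
  have "{c \<in> space ?P. \<exists>J\<in>?S. \<forall>j\<in>J. c j \<in> A} = (\<Union>J\<in>?S. {c \<in> space ?P. \<forall>j\<in>J. c j \<in> A})"
    by auto
  also have "P.prob \<dots> \<le> (\<Sum>J\<in>?S. P.prob {c \<in> space ?P. \<forall>j\<in>J. c j \<in> A})"
    by (intro P.finite_measure_subadditive_finite fin) (use meas in auto)
  also have "\<dots> = (card I choose l) * measure N A ^ l"
    by (simp add: each n_subsets [OF I])
  also have "\<dots> \<le> real (card I ^ l) * measure N A ^ l"
  proof (intro mult_right_mono)
    have "card I choose l \<le> card I ^ l"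
      by (cases "l \<le> card I") (simp_all add: binomial_le_pow binomial_eq_0)
    then show "real (card I choose l) \<le> real (card I ^ l)" by (rule of_nat_mono)
  qed simp
  finally show ?thesis by (simp add: power_mult_distrib)
qed

text \<open>
  The list error event, written with index sets of competitors instead of lists of codewords, so that
  it makes sense and is measurable for codebooks with repetitions.
\<close>

definition outvoted :: "('a \<Rightarrow> 'a \<Rightarrow> 'b \<Rightarrow> bool) \<Rightarrow> nat \<Rightarrow> nat set \<Rightarrow> (nat \<Rightarrow> 'a) \<Rightarrow> 'a \<Rightarrow> 'b \<Rightarrow> bool" where
  "outvoted close l I c x g \<longleftrightarrow> (\<exists>J\<in>{J. J \<subseteq> I \<and> card J = l}. \<forall>j\<in>J. close (c j) x g)"

lemma measurable_outvoted:
  assumes close: "Measurable.pred (N \<Otimes>\<^sub>M N \<Otimes>\<^sub>M G) (\<lambda>(x', x, g). close x' x g)" and I: "finite I"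
    and c: "\<And>i. i \<in> I \<Longrightarrow> (\<lambda>z. c z i) \<in> measurable K N"
    and [measurable]: "x \<in> measurable K N" "g \<in> measurable K G"
  shows "Measurable.pred K (\<lambda>z. outvoted close l I (c z) (x z) (g z))"
proof -
  have *: "Measurable.pred K (\<lambda>z. close (c z j) (x z) (g z))" if "j \<in> I" for j
  proof -
    note c [OF that, measurable]
    have "(\<lambda>z. (c z j, x z, g z)) \<in> measurable K (N \<Otimes>\<^sub>M N \<Otimes>\<^sub>M G)" by measurable
    from measurable_compose [OF this close] show ?thesis by simp
  qed
  have fin: "finite {J. J \<subseteq> I \<and> card J = l}"
    using I by (auto intro: finite_subset [OF _ finite_Pow_iff [THEN iffD2, OF I]])
  show ?thesis unfolding outvoted_def
    by (intro pred_intros_finite fin *) (use I in \<open>auto intro: finite_subset\<close>)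
qed

lemma (in sigma_finite_measure) measurable_emeasure_pred:
  assumes "Measurable.pred (K \<Otimes>\<^sub>M M) (\<lambda>z. P (fst z) (snd z))"
  shows "(\<lambda>x. emeasure M {g \<in> space M. P x g}) \<in> borel_measurable K"
proof (rule measurable_emeasure)
  have "{z \<in> space (K \<Otimes>\<^sub>M M). snd z \<in> {g \<in> space M. P (fst z) g}}
      = {z \<in> space (K \<Otimes>\<^sub>M M). P (fst z) (snd z)}"
    by (auto simp: space_pair_measure)
  also have "\<dots> \<in> sets (K \<Otimes>\<^sub>M M)" using assms by measurable
  finally show "{z \<in> space (K \<Otimes>\<^sub>M M). snd z \<in> {g \<in> space M. P (fst z) g}} \<in> sets (K \<Otimes>\<^sub>M M)" .
qed auto

text \<open>
  The transmitted codeword and the noise must be fixed before the union bound over the other codewords is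
  capped at \<open>1\<close>; hence Fubini is used twice, once to split off coordinate \<open>i\<close> of the codebook and once to
  exchange the remaining coordinates with the noise.
\<close>

lemma random_codebook_error:
  fixes N :: "'a measure" and G :: "'b measure"
  assumes N: "prob_space N" and G: "prob_space G"
    and close: "Measurable.pred (N \<Otimes>\<^sub>M N \<Otimes>\<^sub>M G) (\<lambda>(x', x, g). close x' x g)"
    and bound: "AE x in N. (\<integral>\<^sup>+g. min 1 (ennreal ((real M * measure N {x' \<in> space N. close x' x g}) ^ l)) \<partial>G) \<le> \<epsilon>"
    and i: "i < M"
  shows "(\<integral>\<^sup>+c. emeasure G {g \<in> space G. outvoted close l ({..<M} - {i}) c (c i) g} \<partial>Pi\<^sub>M {..<M} (\<lambda>_. N)) \<le> \<epsilon>"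
proof -
  interpret N: prob_space N by fact
  interpret G: prob_space G by fact
  interpret product_sigma_finite "\<lambda>_::nat. N"
    by (simp add: product_sigma_finite_def N.sigma_finite_measure_axioms)
  define I where "I = {..<M} - {i}"
  have I: "finite I" "i \<notin> I" "insert i I = {..<M}" and "card I \<le> M" using i by (auto simp: I_def)
  interpret P: prob_space "Pi\<^sub>M I (\<lambda>_. N)" by (intro prob_space_PiM N)
  interpret PG: pair_sigma_finite "Pi\<^sub>M I (\<lambda>_. N)" G ..
  have m1: "Measurable.pred (Pi\<^sub>M (insert i I) (\<lambda>_. N) \<Otimes>\<^sub>M G) (\<lambda>z. outvoted close l I (fst z) (fst z i) (snd z))"
    by (intro measurable_outvoted [OF close I(1)]) auto
  have m2: "Measurable.pred (Pi\<^sub>M I (\<lambda>_. N) \<Otimes>\<^sub>M G) (\<lambda>z. outvoted close l I (fst z) x (snd z))"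
    if "x \<in> space N" for x
    using that by (intro measurable_outvoted [OF close I(1)]) auto
  have inner: "(\<integral>\<^sup>+c. emeasure G {g \<in> space G. outvoted close l I c x g} \<partial>Pi\<^sub>M I (\<lambda>_. N))
      \<le> (\<integral>\<^sup>+g. min 1 (ennreal ((real M * measure N {x' \<in> space N. close x' x g}) ^ l)) \<partial>G)"
    if x: "x \<in> space N" for x
  proof -
    note [measurable] = m2 [OF x]
    have "(\<integral>\<^sup>+c. emeasure G {g \<in> space G. outvoted close l I c x g} \<partial>Pi\<^sub>M I (\<lambda>_. N))
        = (\<integral>\<^sup>+c. \<integral>\<^sup>+g. (if outvoted close l I c x g then 1 else 0) \<partial>G \<partial>Pi\<^sub>M I (\<lambda>_. N))"
    proof (intro nn_integral_cong)
      fix c assume c: "c \<in> space (Pi\<^sub>M I (\<lambda>_. N))"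
      have "Measurable.pred G (\<lambda>g. outvoted close l I c x g)"
        using c x by (intro measurable_outvoted [OF close I(1)]) (auto simp: space_PiM PiE_iff)
      then have "{g \<in> space G. outvoted close l I c x g} \<in> sets G" by measurable
      from nn_integral_indicator [OF this, symmetric]
      show "emeasure G {g \<in> space G. outvoted close l I c x g} =
            (\<integral>\<^sup>+g. (if outvoted close l I c x g then 1 else 0) \<partial>G)"
        by (auto simp: indicator_def intro!: nn_integral_cong)
    qed
    also have "\<dots> = (\<integral>\<^sup>+g. \<integral>\<^sup>+c. (if outvoted close l I c x g then 1 else 0) \<partial>Pi\<^sub>M I (\<lambda>_. N) \<partial>G)"
    proof (rule PG.Fubini' [symmetric])
      show "(\<lambda>(c, g). if outvoted close l I c x g then 1 else 0 :: ennreal) \<in> borel_measurable (Pi\<^sub>M I (\<lambda>_. N) \<Otimes>\<^sub>M G)"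
        unfolding split_beta' by measurable
    qed
    also have "\<dots> \<le> (\<integral>\<^sup>+g. min 1 (ennreal ((real M * measure N {x' \<in> space N. close x' x g}) ^ l)) \<partial>G)"
    proof (intro nn_integral_mono)
      fix g assume g: "g \<in> space G"
      let ?A = "{x' \<in> space N. close x' x g}"
      let ?E = "{c \<in> space (Pi\<^sub>M I (\<lambda>_. N)). outvoted close l I c x g}"
      have A: "?A \<in> sets N"
      proof -
        have "(\<lambda>x'. (x', x, g)) \<in> measurable N (N \<Otimes>\<^sub>M N \<Otimes>\<^sub>M G)" using x g by measurable
        from measurable_compose [OF this close] show ?thesis by simp
      qed
      have "Measurable.pred (Pi\<^sub>M I (\<lambda>_. N)) (\<lambda>c. outvoted close l I c x g)"
        using g x by (intro measurable_outvoted [OF close I(1)]) auto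
      then have E: "?E \<in> sets (Pi\<^sub>M I (\<lambda>_. N))" by measurable
      have "(\<integral>\<^sup>+c. (if outvoted close l I c x g then 1 else 0) \<partial>Pi\<^sub>M I (\<lambda>_. N)) = emeasure (Pi\<^sub>M I (\<lambda>_. N)) ?E"
        using nn_integral_indicator [OF E, symmetric]
        by (auto simp: indicator_def intro!: nn_integral_cong)
      also have "\<dots> = ennreal (P.prob ?E)" by (rule P.emeasure_eq_measure)
      also have "P.prob ?E = P.prob {c \<in> space (Pi\<^sub>M I (\<lambda>_. N)). \<exists>J\<in>{J. J \<subseteq> I \<and> card J = l}. \<forall>j\<in>J. c j \<in> ?A}"
        by (rule arg_cong [where f = P.prob]) (auto simp: outvoted_def space_PiM PiE_iff subset_eq)
      also have "ennreal \<dots> \<le> min 1 (ennreal ((real M * measure N ?A) ^ l))"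
      proof -
        have "P.prob {c \<in> space (Pi\<^sub>M I (\<lambda>_. N)). \<exists>J\<in>{J. J \<subseteq> I \<and> card J = l}. \<forall>j\<in>J. c j \<in> ?A}
              \<le> (real (card I) * measure N ?A) ^ l"
          by (rule list_union_bound [OF N I(1) A])
        also have "\<dots> \<le> (real M * measure N ?A) ^ l"
          using \<open>card I \<le> M\<close> by (intro power_mono mult_right_mono) auto
        finally show ?thesis
          using P.prob_le_1 by (simp add: ennreal_leI)
      qed
      finally show "(\<integral>\<^sup>+c. (if outvoted close l I c x g then 1 else 0) \<partial>Pi\<^sub>M I (\<lambda>_. N)) \<le> \<dots>" .
    qed
    finally show ?thesis .
  qed
  have "(\<lambda>c. emeasure G {g \<in> space G. outvoted close l I c (c i) g}) \<in> borel_measurable (Pi\<^sub>M (insert i I) (\<lambda>_. N))"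
    by (rule G.measurable_emeasure_pred [OF m1])
  then have "(\<integral>\<^sup>+c. emeasure G {g \<in> space G. outvoted close l I c (c i) g} \<partial>Pi\<^sub>M (insert i I) (\<lambda>_. N))
    = (\<integral>\<^sup>+x. \<integral>\<^sup>+c. emeasure G {g \<in> space G. outvoted close l I (c(i := x)) ((c(i := x)) i) g} \<partial>Pi\<^sub>M I (\<lambda>_. N) \<partial>N)"
    by (rule product_nn_integral_insert_rev [OF I(1,2)])
  also have "\<dots> = (\<integral>\<^sup>+x. \<integral>\<^sup>+c. emeasure G {g \<in> space G. outvoted close l I c x g} \<partial>Pi\<^sub>M I (\<lambda>_. N) \<partial>N)"
  proof -
    have "outvoted close l I (c(i := x)) x g = outvoted close l I c x g" for c x g
      unfolding outvoted_def using I(2) by (intro bex_cong refl ball_cong) auto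
    then show ?thesis by simp
  qed
  also have "\<dots> \<le> (\<integral>\<^sup>+x. \<epsilon> \<partial>N)"
    using bound by (intro nn_integral_mono_AE) (auto intro: order_trans [OF inner])
  also have "\<dots> = \<epsilon>" by (simp add: N.emeasure_space_1)
  finally show ?thesis unfolding I(3) by (simp add: I_def)
qed

text \<open>
  A code is a set, so repeated codewords would lower the rate. An atomless real coordinate \<open>h\<close>
  of the codewords suffices to exclude repetitions almost surely, and avoids measurability of the diagonal
  of \<open>N\<close>.
\<close>

lemma random_codebook_distinct:
  fixes N :: "'a measure" and h :: "'a \<Rightarrow> real"
  assumes N: "prob_space N" and h [measurable]: "h \<in> borel_measurable N"
    and atomless: "\<And>t. AE x in N. h x \<noteq> t"
  shows "AE c in Pi\<^sub>M {..<M::nat} (\<lambda>_. N). inj_on c {..<M}"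
proof -
  interpret N: prob_space N by fact
  interpret product_sigma_finite "\<lambda>_::nat. N"
    by (simp add: product_sigma_finite_def N.sigma_finite_measure_axioms)
  let ?P = "Pi\<^sub>M {..<M} (\<lambda>_. N)"
  have "AE c in ?P. h (c i) \<noteq> h (c j)" if ij: "i < M" "j < M" "i \<noteq> j" for i j
  proof -
    define I where "I = {..<M} - {i}"
    have I: "finite I" "i \<notin> I" "insert i I = {..<M}" "j \<in> I" using ij by (auto simp: I_def)
    have [measurable]: "Measurable.pred (Pi\<^sub>M (insert i I) (\<lambda>_. N)) (\<lambda>c. h (c i) = h (c j))"
    proof -
      have "(\<lambda>c. c k) \<in> measurable (Pi\<^sub>M (insert i I) (\<lambda>_. N)) N" if "k \<in> insert i I" for k
        using that by (rule measurable_component_singleton)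
      from measurable_compose [OF this h]
      have "(\<lambda>c. h (c k)) \<in> borel_measurable (Pi\<^sub>M (insert i I) (\<lambda>_. N))" if "k \<in> insert i I" for k
        using that .
      then show ?thesis using I(4) unfolding pred_def by (intro borel_measurable_eq) auto
    qed
    have "(\<integral>\<^sup>+c. (if h (c i) = h (c j) then 1 else 0) \<partial>Pi\<^sub>M (insert i I) (\<lambda>_. N))
        = (\<integral>\<^sup>+c. \<integral>\<^sup>+x. (if h x = h (c j) then 1 else 0) \<partial>N \<partial>Pi\<^sub>M I (\<lambda>_. N))"
      using ij(3) by (subst product_nn_integral_insert [OF I(1,2)]) auto
    also have "\<dots> = (\<integral>\<^sup>+c. 0 \<partial>Pi\<^sub>M I (\<lambda>_. N))"
    proof (intro nn_integral_cong)
      fix c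
      show "(\<integral>\<^sup>+x. (if h x = h (c j) then 1 else 0) \<partial>N) = 0"
        using atomless [of "h (c j)"] by (subst nn_integral_0_iff_AE) auto
    qed
    finally have "(\<integral>\<^sup>+c. (if h (c i) = h (c j) then 1 else 0) \<partial>Pi\<^sub>M (insert i I) (\<lambda>_. N)) = 0"
      by simp
    then have "AE c in Pi\<^sub>M (insert i I) (\<lambda>_. N). (if h (c i) = h (c j) then 1 else 0) = (0::ennreal)"
      by (intro nn_integral_0_iff_AE [THEN iffD1]) auto
    then show ?thesis unfolding I(3) by eventually_elim (auto split: if_splits)
  qed
  then have "AE c in ?P. \<forall>i\<in>{..<M}. \<forall>j\<in>{..<M}. i \<noteq> j \<longrightarrow> h (c i) \<noteq> h (c j)"
    by (intro AE_finite_allI) auto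
  then show ?thesis
    by eventually_elim (metis (mono_tags, lifting) inj_on_def)
qed

text \<open>
  Some codebook has at most twice the expected error. The factor \<open>2\<close> turns the comparison with the
  expectation into a strict one, so that null sets of bad codebooks can be discarded.
\<close>

lemma random_coding:
  fixes N :: "'a measure" and G :: "'b measure" and h :: "'a \<Rightarrow> real"
  assumes N: "prob_space N" and G: "prob_space G"
    and close: "Measurable.pred (N \<Otimes>\<^sub>M N \<Otimes>\<^sub>M G) (\<lambda>(x', x, g). close x' x g)"
    and bound: "AE x in N. (\<integral>\<^sup>+g. min 1 (ennreal ((real M * measure N {x' \<in> space N. close x' x g}) ^ l)) \<partial>G)
                  \<le> ennreal \<epsilon>"
    and h: "h \<in> borel_measurable N" and atomless: "\<And>t. AE x in N. h x \<noteq> t"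
    and Q: "AE x in N. Q x" and "0 < \<epsilon>" and "0 < M"
  obtains c where "\<And>i. i < M \<Longrightarrow> c i \<in> space N" "\<And>i. i < M \<Longrightarrow> Q (c i)" "inj_on c {..<M}"
    "(\<Sum>i<M. measure G {g \<in> space G. outvoted close l ({..<M} - {i}) c (c i) g}) \<le> 2 * real M * \<epsilon>"
proof -
  interpret N: prob_space N by fact
  interpret G: prob_space G by fact
  let ?P = "Pi\<^sub>M {..<M} (\<lambda>_. N)"
  interpret P: prob_space ?P by (intro prob_space_PiM N)
  define F where "F i c = emeasure G {g \<in> space G. outvoted close l ({..<M} - {i}) c (c i) g}" for i c
  have [measurable]: "F i \<in> borel_measurable ?P" if "i < M" for i
    unfolding F_def
    using that by (intro G.measurable_emeasure_pred measurable_outvoted [OF close]) auto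
  have "(\<integral>\<^sup>+c. (\<Sum>i<M. F i c) \<partial>?P) = (\<Sum>i<M. \<integral>\<^sup>+c. F i c \<partial>?P)"
    by (intro nn_integral_sum) auto
  also have "\<dots> \<le> (\<Sum>i<M. ennreal \<epsilon>)"
    unfolding F_def using bound by (intro sum_mono random_codebook_error [OF N G close]) auto
  also have "\<dots> = ennreal (real M * \<epsilon>)" using \<open>0 < \<epsilon>\<close> by (simp add: ennreal_of_nat_eq_real_of_nat ennreal_mult)
  also have "\<dots> < ennreal (2 * real M * \<epsilon>)" using \<open>0 < \<epsilon>\<close> \<open>0 < M\<close> by (intro ennreal_lessI) auto
  finally have less: "(\<integral>\<^sup>+c. (\<Sum>i<M. F i c) \<partial>?P) < ennreal (2 * real M * \<epsilon>)" .
  have Qs: "AE c in ?P. \<forall>i\<in>{..<M}. Q (c i)"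
    using Q by (intro AE_finite_allI AE_PiM_component [OF N]) auto
  note distinct = random_codebook_distinct [OF N h atomless, of M]
  have "\<exists>c\<in>space ?P. (\<forall>i\<in>{..<M}. Q (c i)) \<and> inj_on c {..<M} \<and> (\<Sum>i<M. F i c) \<le> ennreal (2 * real M * \<epsilon>)"
  proof (rule ccontr)
    assume contra: "\<not> ?thesis"
    have "AE c in ?P. ennreal (2 * real M * \<epsilon>) \<le> (\<Sum>i<M. F i c)"
      using Qs distinct AE_space by eventually_elim (use contra in force)
    then have "(\<integral>\<^sup>+c. ennreal (2 * real M * \<epsilon>) \<partial>?P) \<le> (\<integral>\<^sup>+c. (\<Sum>i<M. F i c) \<partial>?P)"
      by (rule nn_integral_mono_AE)
    with less show False by (simp add: P.emeasure_space_1)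
  qed
  then obtain c where c: "c \<in> space ?P" "\<forall>i\<in>{..<M}. Q (c i)" "inj_on c {..<M}"
    "(\<Sum>i<M. F i c) \<le> ennreal (2 * real M * \<epsilon>)" by blast
  have "ennreal (\<Sum>i<M. measure G {g \<in> space G. outvoted close l ({..<M} - {i}) c (c i) g}) = (\<Sum>i<M. F i c)"
    by (simp add: F_def G.emeasure_eq_measure)
  with c(4) have "ennreal (\<Sum>i<M. measure G {g \<in> space G. outvoted close l ({..<M} - {i}) c (c i) g})
      \<le> ennreal (2 * real M * \<epsilon>)" by (simp only:)
  then have "(\<Sum>i<M. measure G {g \<in> space G. outvoted close l ({..<M} - {i}) c (c i) g}) \<le> 2 * real M * \<epsilon>"
    using \<open>0 < \<epsilon>\<close> by (subst (asm) ennreal_le_iff) auto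
  then show ?thesis using c(1,2,3) by (intro that [of c]) (auto simp: space_PiM PiE_iff)
qed

section \<open>The error exponent of shell inputs\<close>

text \<open>
  The exponent that the random-coding calculation yields for inputs of Gaussian variance \<open>v\<close>
  conditioned on squared norm at least \<open>n * p\<close>, with Gallager's parameter \<open>\<rho>\<close> and tilt \<open>r\<close>. Here \<open>\<kappa>\<close>
  is the decoding parameter \<open>1 / (2 * \<sigma>\<^sup>2 * (1 + \<rho>))\<close>; the four summands come from the lower edge of
  the shell, the pairwise Gaussian integral, the noise integral and the remaining dependence on the
  transmitted codeword.
\<close>

definition shell_exponent :: "real \<Rightarrow> real \<Rightarrow> real \<Rightarrow> real \<Rightarrow> real \<Rightarrow> real" where
  "shell_exponent \<sigma> \<rho> r v p =
     (let \<kappa> = 1 / (2 * \<sigma>\<^sup>2 * (1 + \<rho>)); \<alpha> = 1 / (2 * v) - r; b = \<rho> * (\<alpha> * \<kappa> / (\<alpha> + \<kappa>))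
      in \<rho> * r * p + \<rho> / 2 * ln (2 * v * (\<alpha> + \<kappa>)) + 1/2 * ln (2 * \<sigma>\<^sup>2 * (\<kappa> + b)) + \<kappa> * b / (\<kappa> + b) * p)"

text \<open>
  Gallager's interpolation: a probability that is bounded both by \<open>1\<close> and by \<open>z ^ l\<close> is bounded by
  every intermediate power of \<open>z\<close>. The estimate \<open>Z\<close> of \<open>z\<close> has to be positive because \<open>0 powr 0 = 0\<close>.
\<close>

lemma min_power_le_powr:
  fixes z Z \<rho> :: real
  assumes "0 \<le> z" "z \<le> Z" "0 < Z" "0 \<le> \<rho>" "\<rho> \<le> real l"
  shows "min 1 (z ^ l) \<le> Z powr \<rho>"
proof (cases "1 \<le> Z")
  case True
  then show ?thesis using assms by (simp add: ge_one_powr_ge_zero min.coboundedI1)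
next
  case False
  have "z ^ l \<le> Z ^ l" using assms by (intro power_mono) auto
  also have "\<dots> = Z powr real l" using assms by (simp add: powr_realpow)
  also have "\<dots> \<le> Z powr \<rho>" using assms False by (intro powr_mono') auto
  finally show ?thesis by (simp add: min.coboundedI2)
qed

text \<open>
  The calculation behind the exponent. For fixed \<open>x\<close> and \<open>g\<close>, the probability \<open>q g\<close> that a random
  codeword beats \<open>x\<close> is estimated by \<open>exp (r * (\<bar>x'\<bar>\<^sup>2 - n * p)) * exp (\<kappa> * (\<bar>g\<bar>\<^sup>2 - \<bar>x' - (x + g)\<bar>\<^sup>2))\<close>,
  which is at least \<open>1\<close> on the event, and which integrates to the Gaussian function \<open>H\<close> of \<open>g\<close>. The \<open>\<rho>\<close>-th
  power of \<open>H\<close> is integrated against the noise; the result is a nonincreasing function of \<open>\<bar>x\<bar>\<^sup>2\<close>, hence at most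
  its value at \<open>n * p\<close>. So the bound holds for every codeword of the shell and not only on average,
  which saves the integral over the transmitted codeword.
\<close>

lemma shell_input_error:
  fixes \<sigma> \<tau> \<rho> r p P :: real and n :: nat
  assumes "0 < \<sigma>" "0 < \<tau>" "0 \<le> \<rho>" "\<rho> \<le> real l" "0 \<le> r" "r \<le> 1 / (2 * \<tau>\<^sup>2)" "0 < M"
  defines "S \<equiv> {x \<in> space (awgn_noise n \<tau>). real n * p \<le> sqnorm n x \<and> sqnorm n x \<le> real n * P}"
  assumes mass: "1/2 \<le> measure (awgn_noise n \<tau>) S" and x: "x \<in> S"
  shows "(\<integral>\<^sup>+g. min 1 (ennreal ((real M * measure (uniform_measure (awgn_noise n \<tau>) S)
              {x' \<in> space (uniform_measure (awgn_noise n \<tau>) S).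
                 sqnorm n (\<lambda>i. x' i - (x i + g i)) < sqnorm n g}) ^ l)) \<partial>awgn_noise n \<sigma>)
         \<le> ennreal ((2 * real M) powr \<rho> * exp (- real n * shell_exponent \<sigma> \<rho> r (\<tau>\<^sup>2) p))"
proof -
  let ?T = "awgn_noise n \<tau>" and ?G = "awgn_noise n \<sigma>"
  let ?N = "uniform_measure ?T S"
  interpret T: prob_space ?T using assms(2) by (rule prob_space_awgn_noise)
  have S [measurable]: "S \<in> sets ?T" unfolding S_def by measurable
  define \<kappa> where "\<kappa> = 1 / (2 * \<sigma>\<^sup>2 * (1 + \<rho>))"
  define \<alpha> where "\<alpha> = 1 / (2 * \<tau>\<^sup>2) - r"
  define b where "b = \<alpha> * \<kappa> / (\<alpha> + \<kappa>)"
  define A where "A = 2 * \<tau>\<^sup>2 * (\<alpha> + \<kappa>)"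
  define B where "B = 2 * \<sigma>\<^sup>2 * (\<kappa> + \<rho> * b)"
  have \<kappa>: "0 < \<kappa>" and \<alpha>: "0 \<le> \<alpha>" using assms by (simp_all add: \<kappa>_def \<alpha>_def)
  have b: "0 \<le> b" using \<kappa> \<alpha> by (simp add: b_def)
  have AB: "0 < A" "0 < B"
    using \<kappa> \<alpha> b assms(1-3) by (auto simp: A_def B_def intro!: mult_pos_pos add_nonneg_pos add_pos_nonneg)
  define q where "q g = measure ?N {x' \<in> space ?N. sqnorm n (\<lambda>i. x' i - (x i + g i)) < sqnorm n g}" for g
  define H where "H g = 2 * exp (\<kappa> * sqnorm n g - real n * r * p)
      * (exp (- b * sqnorm n (\<lambda>i. x i + g i)) / sqrt A ^ n)" for g
  have Hpos: "0 < H g" for g using AB by (simp add: H_def)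
  have q_le: "q g \<le> H g" for g
  proof -
    let ?C = "{x' \<in> space ?T. sqnorm n (\<lambda>i. x' i - (x i + g i)) < sqnorm n g}"
    have C [measurable]: "?C \<in> sets ?T" unfolding sqnorm_def by measurable
    have "emeasure ?T (S \<inter> ?C) = (\<integral>\<^sup>+x'. indicator (S \<inter> ?C) x' \<partial>?T)" by simp
    also have "\<dots> \<le> (\<integral>\<^sup>+x'. ennreal (exp (\<kappa> * sqnorm n g - real n * r * p))
        * ennreal (exp (r * sqnorm n x' - \<kappa> * sqnorm n (\<lambda>i. x' i - (x i + g i)))) \<partial>?T)"
    proof (intro nn_integral_mono)
      fix x'
      have "1 \<le> exp (\<kappa> * sqnorm n g - real n * r * p) * exp (r * sqnorm n x' - \<kappa> * sqnorm n (\<lambda>i. x' i - (x i + g i)))"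
        if "x' \<in> S \<inter> ?C"
      proof -
        have "r * (real n * p) \<le> r * sqnorm n x'"
          using that assms(5) by (intro mult_left_mono) (auto simp: S_def)
        moreover have "\<kappa> * sqnorm n (\<lambda>i. x' i - (x i + g i)) \<le> \<kappa> * sqnorm n g"
          using that \<kappa> by (intro mult_left_mono) auto
        ultimately show ?thesis by (simp add: exp_add [symmetric] algebra_simps)
      qed
      then show "indicator (S \<inter> ?C) x' \<le> ennreal (exp (\<kappa> * sqnorm n g - real n * r * p))
        * ennreal (exp (r * sqnorm n x' - \<kappa> * sqnorm n (\<lambda>i. x' i - (x i + g i))))"
        unfolding indicator_def by (auto simp: ennreal_mult' [symmetric] ennreal_1 [symmetric]
         simp del: ennreal_1 intro!: ennreal_leI)
    qed
    also have "\<dots> = ennreal (exp (\<kappa> * sqnorm n g - real n * r * p))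
        * ennreal (exp (- b * sqnorm n (\<lambda>i. x i + g i)) / sqrt A ^ n)"
    proof -
      have "0 < \<alpha> + \<kappa>" using \<alpha> \<kappa> by simp
      from gaussian_quadratic_integral [OF assms(2) \<alpha>_def this, of n "\<lambda>i. x i + g i"]
      show ?thesis unfolding A_def b_def
        by (subst nn_integral_cmult) (auto simp: sqnorm_def)
    qed
    also have "\<dots> = ennreal (H g / 2)" by (simp add: H_def ennreal_mult' [symmetric])
    finally have "T.prob (S \<inter> ?C) \<le> H g / 2"
      using Hpos [of g] by (simp add: T.emeasure_eq_measure)
    \<comment> \<open>the factor \<open>2\<close> of \<open>H\<close> pays for conditioning on the shell\<close>
    then have "T.prob (S \<inter> ?C) / T.prob S \<le> (H g / 2) / (1/2)"
      using mass Hpos [of g] by (intro frac_le) auto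
    moreover have "q g = T.prob (S \<inter> ?C) / T.prob S"
      unfolding q_def using S C mass
      by (subst measure_uniform_measure) (auto simp: T.emeasure_eq_measure)
    ultimately show ?thesis by simp
  qed
  have "(\<integral>\<^sup>+g. min 1 (ennreal ((real M * q g) ^ l)) \<partial>?G)
     \<le> (\<integral>\<^sup>+g. ennreal ((2 * real M) powr \<rho> * exp (- (real n * (\<rho> * r * p + \<rho> / 2 * ln A))))
          * ennreal (exp ((\<rho> * \<kappa>) * sqnorm n g - (\<rho> * b) * sqnorm n (\<lambda>i. g i - (- x i)))) \<partial>?G)"
  proof (intro nn_integral_mono)
    fix g
    have "min 1 ((real M * q g) ^ l) \<le> (real M * H g) powr \<rho>"
      using q_le [of g] Hpos [of g] assms by (intro min_power_le_powr) (auto simp: q_def)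
    also have "real M * H g = (2 * real M) * exp (\<kappa> * sqnorm n g - real n * r * p
         - b * sqnorm n (\<lambda>i. x i + g i) - real n / 2 * ln A)"
    proof -
      have "sqrt A ^ n = exp (real n / 2 * ln A)"
        using AB by (simp add: powr_half_sqrt [symmetric] powr_def exp_of_nat_mult [symmetric])
      then show ?thesis by (simp add: H_def exp_add [symmetric] exp_diff [symmetric])
    qed
    also have "\<dots> powr \<rho> = (2 * real M) powr \<rho> * exp (\<rho> * (\<kappa> * sqnorm n g - real n * r * p
         - b * sqnorm n (\<lambda>i. x i + g i) - real n / 2 * ln A))"
      by (subst powr_mult) (auto simp: powr_def)
    also have "\<dots> = ((2 * real M) powr \<rho> * exp (- (real n * (\<rho> * r * p + \<rho> / 2 * ln A))))
          * exp ((\<rho> * \<kappa>) * sqnorm n g - (\<rho> * b) * sqnorm n (\<lambda>i. g i - (- x i)))"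
      by (simp add: exp_add [symmetric] mult.assoc algebra_simps)
    finally have "ennreal (min 1 ((real M * q g) ^ l)) \<le> ennreal \<dots>" by (rule ennreal_leI)
    then show "min 1 (ennreal ((real M * q g) ^ l))
        \<le> ennreal ((2 * real M) powr \<rho> * exp (- (real n * (\<rho> * r * p + \<rho> / 2 * ln A))))
          * ennreal (exp ((\<rho> * \<kappa>) * sqnorm n g - (\<rho> * b) * sqnorm n (\<lambda>i. g i - (- x i))))"
      by (simp add: ennreal_mult' [symmetric] min_def q_def split: if_splits)
  qed
  also have "\<dots> = ennreal ((2 * real M) powr \<rho> * exp (- (real n * (\<rho> * r * p + \<rho> / 2 * ln A))))
      * ennreal (exp (- (\<kappa> * (\<rho> * b) / (\<kappa> + \<rho> * b)) * sqnorm n (\<lambda>i. - x i)) / sqrt B ^ n)"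
  proof -
    \<comment> \<open>the choice of \<open>\<kappa>\<close> makes half the precision left by the noise equal to the decoding parameter itself\<close>
    have "\<kappa> = 1 / (2 * \<sigma>\<^sup>2) - \<rho> * \<kappa>"
    proof -
      have "\<kappa> * (1 + \<rho>) = 1 / (2 * \<sigma>\<^sup>2)" using assms(3) by (simp add: \<kappa>_def)
      then show ?thesis by (simp add: distrib_left mult.commute)
    qed
    moreover have "0 < \<kappa> + \<rho> * b" using \<kappa> b assms(3) by (simp add: add_pos_nonneg)
    ultimately show ?thesis
      using gaussian_quadratic_integral [OF assms(1), of \<kappa> "\<rho> * \<kappa>" "\<rho> * b" n "\<lambda>i. - x i"]
      by (subst nn_integral_cmult) (auto simp: sqnorm_def B_def)
  qed
  also have "\<dots> \<le> ennreal ((2 * real M) powr \<rho> * exp (- (real n * (\<rho> * r * p + \<rho> / 2 * ln A))))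
      * ennreal (exp (- (\<kappa> * (\<rho> * b) / (\<kappa> + \<rho> * b)) * (real n * p)) / sqrt B ^ n)"
  proof (intro mult_left_mono ennreal_leI divide_right_mono)
    have d: "0 \<le> \<kappa> * (\<rho> * b) / (\<kappa> + \<rho> * b)" using \<kappa> b assms(3) by simp
    have "real n * p \<le> sqnorm n (\<lambda>i. - x i)" using x by (simp add: S_def sqnorm_def)
    from mult_left_mono [OF this d]
    show "exp (- (\<kappa> * (\<rho> * b) / (\<kappa> + \<rho> * b)) * sqnorm n (\<lambda>i. - x i))
        \<le> exp (- (\<kappa> * (\<rho> * b) / (\<kappa> + \<rho> * b)) * (real n * p))"
      by simp
  qed (use AB in auto)
  also have "\<dots> = ennreal ((2 * real M) powr \<rho> * exp (- real n * shell_exponent \<sigma> \<rho> r (\<tau>\<^sup>2) p))"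
  proof -
    define d where "d = \<kappa> * (\<rho> * b) / (\<kappa> + \<rho> * b)"
    define X where "X = \<rho> * r * p + \<rho> / 2 * ln A"
    have sB: "sqrt B ^ n = exp (real n / 2 * ln B)"
      using AB by (simp add: powr_half_sqrt [symmetric] powr_def exp_of_nat_mult [symmetric])
    have "shell_exponent \<sigma> \<rho> r (\<tau>\<^sup>2) p = X + 1/2 * ln B + d * p"
      unfolding shell_exponent_def Let_def X_def d_def A_def B_def b_def \<alpha>_def \<kappa>_def ..
    then have "- (real n * X) + (- d * (real n * p) - real n / 2 * ln B)
        = - real n * shell_exponent \<sigma> \<rho> r (\<tau>\<^sup>2) p"
      by (simp add: algebra_simps)
    then have eq: "exp (- (real n * X)) * (exp (- d * (real n * p)) / sqrt B ^ n)
        = exp (- real n * shell_exponent \<sigma> \<rho> r (\<tau>\<^sup>2) p)"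
      unfolding sB by (simp only: exp_add [symmetric] exp_diff [symmetric])
    show ?thesis
      unfolding d_def [symmetric] X_def [symmetric]
      by (subst ennreal_mult' [symmetric]) (simp_all only: mult.assoc eq mult_nonneg_nonneg powr_ge_zero exp_ge_zero)
  qed
  finally show ?thesis unfolding q_def .
qed

definition closer :: "nat \<Rightarrow> (nat \<Rightarrow> real) \<Rightarrow> (nat \<Rightarrow> real) \<Rightarrow> (nat \<Rightarrow> real) \<Rightarrow> bool" where
  "closer n x' x g \<longleftrightarrow> sqnorm n (\<lambda>i. x' i - (x i + g i)) < sqnorm n g"

lemma measurable_closer:
  assumes N: "sets N = sets (Pi\<^sub>M {..<n} (\<lambda>_. borel))" and G: "sets G = sets (Pi\<^sub>M {..<n} (\<lambda>_. borel))"
  shows "Measurable.pred (N \<Otimes>\<^sub>M N \<Otimes>\<^sub>M G) (\<lambda>(x', x, g). closer n x' x g)"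
proof -
  let ?B = "Pi\<^sub>M {..<n} (\<lambda>_. borel :: real measure)"
  have "Measurable.pred (?B \<Otimes>\<^sub>M ?B \<Otimes>\<^sub>M ?B) (\<lambda>(x', x, g). closer n x' x g)"
    unfolding closer_def sqnorm_def split_beta' by measurable
  moreover have "sets (N \<Otimes>\<^sub>M N \<Otimes>\<^sub>M G) = sets (?B \<Otimes>\<^sub>M ?B \<Otimes>\<^sub>M ?B)"
    by (intro sets_pair_measure_cong N G)
  ultimately show ?thesis by (subst measurable_cong_sets [OF _ refl])
qed

lemma ml_list_error_le_outvoted:
  assumes "0 < \<sigma>" and inj: "inj_on c {..<M}" and "i < M" and c: "\<And>j. j < M \<Longrightarrow> c j \<in> {..<n} \<rightarrow>\<^sub>E UNIV"
  shows "ml_list_error n \<sigma> l (c ` {..<M}) (c i)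
    \<le> measure (awgn_noise n \<sigma>) {g \<in> space (awgn_noise n \<sigma>). outvoted (closer n) l ({..<M} - {i}) c (c i) g}"
proof -
  let ?G = "awgn_noise n \<sigma>"
  interpret G: prob_space ?G using assms(1) by (rule prob_space_awgn_noise)
  let ?B = "Pi\<^sub>M {..<n} (\<lambda>_. borel :: real measure)"
  have "Measurable.pred ?G (\<lambda>g. outvoted (closer n) l ({..<M} - {i}) c (c i) g)"
    using c \<open>i < M\<close>
    by (intro measurable_outvoted [OF measurable_closer [where N = ?B, OF refl sets_awgn_noise [of n \<sigma>]]])
       (auto simp: space_PiM)
  then have "{g \<in> space ?G. outvoted (closer n) l ({..<M} - {i}) c (c i) g} \<in> sets ?G" by measurable
  moreover have "outvoted (closer n) l ({..<M} - {i}) c (c i) g"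
    if ys: "length ys = l" "distinct ys" "set ys \<subseteq> c ` {..<M} - {c i}"
      "\<forall>y\<in>set ys. euclid_norm n (\<lambda>k. y k - (c i k + g k)) < euclid_norm n g" for ys g
  proof -
    define J where "J = {j \<in> {..<M}. c j \<in> set ys}"
    have "c ` J = set ys" using ys(3) by (auto simp: J_def)
    moreover have "card (c ` J) = card J"
      by (intro card_image inj_on_subset [OF inj]) (auto simp: J_def)
    ultimately have "card J = l" using ys(1,2) by (simp add: distinct_card)
    moreover have "J \<subseteq> {..<M} - {i}" using ys(3) by (auto simp: J_def)
    moreover have "\<forall>j\<in>J. closer n (c j) (c i) g"
      using ys(4) by (auto simp: J_def closer_def euclid_norm_less_iff)
    ultimately show ?thesis unfolding outvoted_def by blast
  qed
  ultimately show ?thesis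
    unfolding ml_list_error_def by (intro G.finite_measure_mono) auto
qed

lemma shell_code_exists:
  fixes \<sigma> \<tau> \<rho> r p P :: real and n :: nat
  assumes "0 < \<sigma>" "0 < \<tau>" "0 \<le> \<rho>" "\<rho> \<le> real l" "0 \<le> r" "r \<le> 1 / (2 * \<tau>\<^sup>2)" "0 < M" "0 < n"
  assumes mass: "1/2 \<le> measure (awgn_noise n \<tau>)
    {x \<in> space (awgn_noise n \<tau>). real n * p \<le> sqnorm n x \<and> sqnorm n x \<le> real n * P}"
  obtains C where "awgn_code P n C" "card C = M"
    "ml_list_error_avg n \<sigma> l C \<le> 2 * ((2 * real M) powr \<rho> * exp (- real n * shell_exponent \<sigma> \<rho> r (\<tau>\<^sup>2) p))"
proof -
  let ?T = "awgn_noise n \<tau>" and ?G = "awgn_noise n \<sigma>"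
  define S where "S = {x \<in> space ?T. real n * p \<le> sqnorm n x \<and> sqnorm n x \<le> real n * P}"
  define N where "N = uniform_measure ?T S"
  define \<epsilon> where "\<epsilon> = (2 * real M) powr \<rho> * exp (- real n * shell_exponent \<sigma> \<rho> r (\<tau>\<^sup>2) p)"
  have "0 < \<epsilon>" using \<open>0 < M\<close> by (simp add: \<epsilon>_def)
  interpret T: prob_space ?T using assms(2) by (rule prob_space_awgn_noise)
  have S [measurable]: "S \<in> sets ?T" unfolding S_def by measurable
  have N: "prob_space N"
    unfolding N_def using mass
    by (intro prob_space_uniform_measure) (auto simp: S_def [symmetric] T.emeasure_eq_measure)
  have sets_N: "sets N = sets (Pi\<^sub>M {..<n} (\<lambda>_. borel))" by (simp add: N_def sets_awgn_noise)
  have space_N: "space N = {..<n} \<rightarrow>\<^sub>E UNIV" by (simp add: N_def space_awgn_noise)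
  have in_S: "AE x in N. x \<in> S" unfolding N_def by (rule AE_uniform_measureI) auto
  have bound: "AE x in N. (\<integral>\<^sup>+g. min 1 (ennreal ((real M * measure N {x' \<in> space N. closer n x' x g}) ^ l)) \<partial>?G)
                  \<le> ennreal \<epsilon>"
    using in_S
  proof eventually_elim
    case (elim x)
    then show ?case
      using shell_input_error [OF assms(1-7) mass, of x] by (simp add: N_def S_def closer_def \<epsilon>_def)
  qed
  have h: "(\<lambda>x. x 0) \<in> borel_measurable N"
    using \<open>0 < n\<close> by (simp cong: measurable_cong_sets add: sets_N)
  \<comment> \<open>the first coordinate separates the codewords; it exists because \<open>n > 0\<close>\<close>
  have atomless: "AE x in N. x 0 \<noteq> t" for t
  proof -
    have "AE u in density lborel (\<lambda>t. ennreal (normal_density 0 \<tau> t)). u \<noteq> t"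
      by (subst AE_density) (auto intro: eventually_mono [OF AE_lborel_singleton [of t]])
    then have "AE x in ?T. x 0 \<noteq> t"
      unfolding awgn_noise_def using assms(2,8)
      by (intro AE_PiM_component [where i = 0] prob_space_normal_density) auto
    then show ?thesis unfolding N_def by (intro AE_uniform_measureI S) auto
  qed
  obtain c where c: "\<And>i. i < M \<Longrightarrow> c i \<in> space N" "\<And>i. i < M \<Longrightarrow> c i \<in> S" "inj_on c {..<M}"
    and err: "(\<Sum>i<M. measure ?G {g \<in> space ?G. outvoted (closer n) l ({..<M} - {i}) c (c i) g}) \<le> 2 * real M * \<epsilon>"
    using random_coding [OF N prob_space_awgn_noise [OF assms(1)] measurable_closer [OF sets_N sets_awgn_noise]
      bound h atomless in_S \<open>0 < \<epsilon>\<close> \<open>0 < M\<close>] by blast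
  show thesis
  proof (rule that [of "c ` {..<M}"])
    show "awgn_code P n (c ` {..<M})"
      using c(1,2) \<open>0 < M\<close> by (fastforce simp: awgn_code_def space_N S_def euclid_norm_eq_sqrt)
    show card: "card (c ` {..<M}) = M" using card_image [OF c(3)] by simp
    have "(\<Sum>x\<in>c ` {..<M}. ml_list_error n \<sigma> l (c ` {..<M}) x) = (\<Sum>i<M. ml_list_error n \<sigma> l (c ` {..<M}) (c i))"
      by (simp add: sum.reindex [OF c(3)])
    also have "\<dots> \<le> (\<Sum>i<M. measure ?G {g \<in> space ?G. outvoted (closer n) l ({..<M} - {i}) c (c i) g})"
      using c(1) by (intro sum_mono ml_list_error_le_outvoted assms(1) c(3)) (auto simp: space_N)
    finally have "(\<Sum>x\<in>c ` {..<M}. ml_list_error n \<sigma> l (c ` {..<M}) x) \<le> 2 * real M * \<epsilon>"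
      using err by simp
    then show "ml_list_error_avg n \<sigma> l (c ` {..<M}) \<le> 2 * ((2 * real M) powr \<rho> * exp (- real n * shell_exponent \<sigma> \<rho> r (\<tau>\<^sup>2) p))"
      unfolding ml_list_error_avg_def card \<epsilon>_def [symmetric] using \<open>0 < M\<close> by (simp add: field_simps)
  qed
qed

section \<open>Positivity of the error probability\<close>

lemma awgn_noise_box_pos:
  assumes "0 < \<sigma>" "\<And>i. i < n \<Longrightarrow> a i < b i"
  shows "0 < emeasure (awgn_noise n \<sigma>) (\<Pi>\<^sub>E i\<in>{..<n}. {a i<..<b i})"
proof -
  let ?N = "density lborel (\<lambda>t. ennreal (normal_density 0 \<sigma> t))"
  interpret N: prob_space ?N using assms(1) by (rule prob_space_normal_density)
  interpret product_sigma_finite "\<lambda>_::nat. ?N"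
    by (simp add: product_sigma_finite_def N.sigma_finite_measure_axioms)
  have "emeasure ?N {u<..<v} \<noteq> 0" if "u < v" for u v :: real
  proof
    assume "emeasure ?N {u<..<v} = 0"
    then have "(\<integral>\<^sup>+t. ennreal (normal_density 0 \<sigma> t) * indicator {u<..<v} t \<partial>lborel) = 0"
      by (subst (asm) emeasure_density) auto
    then have "AE t in lborel. ennreal (normal_density 0 \<sigma> t) * indicator {u<..<v} t = 0"
      by (subst (asm) nn_integral_0_iff_AE) auto
    then have "AE t in lborel. t \<notin> {u<..<v}"
    proof eventually_elim
      case (elim t)
      show ?case
        using elim normal_density_pos [OF assms(1), of 0 t] by (auto simp: ennreal_eq_0_iff)
    qed
    then have "emeasure lborel {u<..<v} = 0"
      by (subst (asm) AE_iff_measurable [of "{u<..<v}"]) auto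
    with that show False by simp
  qed
  then have "(\<Prod>i<n. emeasure ?N {a i<..<b i}) \<noteq> 0"
    using assms(2) by (simp add: prod_zero_iff)
  then show ?thesis unfolding awgn_noise_def by (subst emeasure_PiM) (auto simp: zero_less_iff_neq_zero)
qed

lemma ml_list_error_nonneg: "0 \<le> ml_list_error n \<sigma> l C x"
  by (simp add: ml_list_error_def)

text \<open>
  Take a codeword \<open>x\<close> of largest norm. No other codeword \<open>y\<close> is longer than \<open>x\<close>, so
  \<open>m y = x \<bullet> (x - y) > 0\<close>, and the noise \<open>- t * x\<close> pushes the output closer to every \<open>y\<close> than to \<open>x\<close> once
  \<open>t\<close> is large. Enlarging \<open>t\<close> further gives room for a whole box of noise vectors, which has
  positive probability.
\<close>

lemma ml_list_error_avg_pos: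
  assumes "0 < \<sigma>" and C: "awgn_code P n C" and l: "l < card C"
  shows "0 < ml_list_error_avg n \<sigma> l C"
proof -
  let ?G = "awgn_noise n \<sigma>"
  interpret G: prob_space ?G using assms(1) by (rule prob_space_awgn_noise)
  have fin: "finite C" "C \<noteq> {}" and ext: "\<And>y. y \<in> C \<Longrightarrow> y \<in> {..<n} \<rightarrow>\<^sub>E UNIV"
    using C by (auto simp: awgn_code_def)
  obtain x where x: "x \<in> C" and max: "\<And>y. y \<in> C \<Longrightarrow> sqnorm n y \<le> sqnorm n x"
  proof -
    have "Max (sqnorm n ` C) \<in> sqnorm n ` C" using fin by (intro Max_in) auto
    then obtain x where "x \<in> C" "Max (sqnorm n ` C) = sqnorm n x" by auto
    then show thesis using fin Max_ge [of "sqnorm n ` C"] by (intro that [of x]) auto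
  qed
  define m where "m y = (\<Sum>i<n. x i * (x i - y i))" for y
  have diff: "sqnorm n (\<lambda>i. y i - (x i + g i)) - sqnorm n g = sqnorm n (\<lambda>i. y i - x i) - 2 * (\<Sum>i<n. g i * (y i - x i))" for y g
    unfolding sqnorm_def sum_distrib_left sum_subtractf [symmetric]
    by (intro sum.cong refl) (simp add: power2_eq_square algebra_simps)
  have mpos: "0 < m y" if y: "y \<in> C - {x}" for y
  proof -
    have "y \<noteq> x" using y by simp
    then obtain i where "i < n" "y i \<noteq> x i"
      using PiE_ext [of y "{..<n}" "\<lambda>_. UNIV" x] ext [of y] ext [of x] x y by auto
    then have "0 < sqnorm n (\<lambda>i. y i - x i)"
      unfolding sqnorm_def by (intro sum_pos2 [of _ i]) auto
    moreover have "2 * m y = sqnorm n x - sqnorm n y + sqnorm n (\<lambda>i. y i - x i)"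
      unfolding sqnorm_def m_def sum_distrib_left sum_subtractf [symmetric] sum.distrib [symmetric]
      by (intro sum.cong refl) (simp add: power2_eq_square algebra_simps)
    ultimately show ?thesis using max [of y] y by simp
  qed
  have "\<forall>\<^sub>F t in at_top. \<forall>y\<in>C - {x}. sqnorm n (\<lambda>i. y i - x i) + 2 * (\<Sum>i<n. \<bar>y i - x i\<bar>) < 2 * (t * m y)"
  proof (intro eventually_ball_finite ballI)
    fix y assume "y \<in> C - {x}"
    then have my: "0 < m y" by (rule mpos)
    show "\<forall>\<^sub>F t in at_top. sqnorm n (\<lambda>i. y i - x i) + 2 * (\<Sum>i<n. \<bar>y i - x i\<bar>) < 2 * (t * m y)"
      using eventually_gt_at_top [of "(sqnorm n (\<lambda>i. y i - x i) + 2 * (\<Sum>i<n. \<bar>y i - x i\<bar>)) / (2 * m y)"]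
      by eventually_elim (use my in \<open>simp add: pos_divide_less_eq mult_ac\<close>)
  qed (use fin in simp)
  then obtain t :: real where t: "\<And>y. y \<in> C - {x} \<Longrightarrow> sqnorm n (\<lambda>i. y i - x i) + 2 * (\<Sum>i<n. \<bar>y i - x i\<bar>) < 2 * (t * m y)"
    using eventually_happens' [OF trivial_limit_at_top_linorder] by blast
  define W where "W = (\<Pi>\<^sub>E i\<in>{..<n}. {- t * x i - 1<..<- t * x i + 1})"
  have W: "closer n y x g" if g: "g \<in> W" and y: "y \<in> C - {x}" for g y
  proof -
    have "t * m y - (\<Sum>i<n. \<bar>y i - x i\<bar>) = (\<Sum>i<n. - t * x i * (y i - x i) - \<bar>y i - x i\<bar>)"
      unfolding m_def sum_distrib_left sum_subtractf [symmetric]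
      by (intro sum.cong refl) (simp add: algebra_simps)
    also have "\<dots> \<le> (\<Sum>i<n. g i * (y i - x i))"
    proof (intro sum_mono)
      fix i assume i: "i \<in> {..<n}"
      have "g i \<in> {- t * x i - 1<..<- t * x i + 1}" using PiE_mem [OF g [unfolded W_def] i] .
      then have "\<bar>- t * x i - g i\<bar> \<le> 1" unfolding abs_le_iff greaterThanLessThan_iff by linarith
      then have "\<bar>- t * x i - g i\<bar> * \<bar>y i - x i\<bar> \<le> 1 * \<bar>y i - x i\<bar>" by (intro mult_right_mono) auto
      then have "(- t * x i - g i) * (y i - x i) \<le> \<bar>y i - x i\<bar>"
        by (simp add: abs_mult [symmetric])
      then show "- t * x i * (y i - x i) - \<bar>y i - x i\<bar> \<le> g i * (y i - x i)" by (simp add: algebra_simps)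
    qed
    finally show ?thesis using t [OF y] diff [of y g] by (simp add: closer_def)
  qed
  let ?E = "{g \<in> space ?G. \<exists>ys. length ys = l \<and> distinct ys \<and> set ys \<subseteq> C - {x} \<and>
            (\<forall>y\<in>set ys. euclid_norm n (\<lambda>i. y i - (x i + g i)) < euclid_norm n g)}"
  have "W \<subseteq> ?E"
  proof
    fix g assume g: "g \<in> W"
    have "l \<le> card (C - {x})" using l x fin by simp
    then obtain Y where "Y \<subseteq> C - {x}" "card Y = l" "finite Y" by (rule obtain_subset_with_card_n)
    moreover obtain ys where "set ys = Y" "distinct ys" using finite_distinct_list [OF \<open>finite Y\<close>] by blast
    moreover have "g \<in> space ?G" using g by (simp add: W_def space_awgn_noise PiE_iff)
    ultimately show "g \<in> ?E"
      using W [OF g] by (auto simp: distinct_card [symmetric] euclid_norm_less_iff closer_def subset_eq intro!: exI [of _ ys])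
  qed
  moreover have "?E \<in> sets ?G"
  proof -
    let ?L = "{ys. set ys \<subseteq> C - {x} \<and> length ys = l}"
    have "finite ?L" using fin by (intro finite_lists_length_eq) simp
    moreover have "{g \<in> space ?G. distinct ys \<and> (\<forall>y\<in>set ys. sqnorm n (\<lambda>i. y i - (x i + g i)) < sqnorm n g)} \<in> sets ?G" for ys
      unfolding sqnorm_def by measurable
    ultimately have "(\<Union>ys\<in>?L. {g \<in> space ?G. distinct ys \<and> (\<forall>y\<in>set ys. sqnorm n (\<lambda>i. y i - (x i + g i)) < sqnorm n g)}) \<in> sets ?G"
      by (intro sets.finite_UN) auto
    also have "(\<Union>ys\<in>?L. {g \<in> space ?G. distinct ys \<and> (\<forall>y\<in>set ys. sqnorm n (\<lambda>i. y i - (x i + g i)) < sqnorm n g)}) = ?E"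
      by (auto simp: euclid_norm_less_iff)
    finally show ?thesis .
  qed
  ultimately have "emeasure ?G W \<le> emeasure ?G ?E" by (intro emeasure_mono)
  moreover have "0 < emeasure ?G W" unfolding W_def using assms(1) by (intro awgn_noise_box_pos) auto
  ultimately have "0 < ml_list_error n \<sigma> l C x"
    unfolding ml_list_error_def by (simp add: G.emeasure_eq_measure order_less_le_trans)
  then have "0 < (\<Sum>x\<in>C. ml_list_error n \<sigma> l C x)"
    using x fin by (intro sum_pos2 [of _ x]) (auto simp: ml_list_error_nonneg)
  then show ?thesis using fin by (simp add: ml_list_error_avg_def card_gt_0_iff)
qed

section \<open>Gallager's quadratic and the two bounds\<close>

lemma R_crit_root:
  fixes s :: real and L :: nat
  assumes "0 < s" "2 \<le> L" defines "\<beta> \<equiv> exp (2 * R_crit L s)"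
  shows "\<beta> = (real L + s + sqrt ((real L - s)\<^sup>2 + 4 * s)) / (2 * real L)" and "1 < \<beta>"
proof -
  let ?D = "sqrt ((real L - s)\<^sup>2 + 4 * s)"
  have L: "0 < real L" using assms by simp
  have "1 - 2 * (real L - 2) / (real L)\<^sup>2 * s + s\<^sup>2 / (real L)\<^sup>2 = ((real L - s)\<^sup>2 + 4 * s) / (real L)\<^sup>2"
    using L by (simp add: field_simps power2_eq_square)
  then have rt: "sqrt (1 - 2 * (real L - 2) / (real L)\<^sup>2 * s + s\<^sup>2 / (real L)\<^sup>2) = ?D / real L"
    using L by (simp add: real_sqrt_divide)
  have "\<bar>real L - s\<bar> < ?D" using \<open>0 < s\<close> by (intro real_less_rsqrt) (simp add: power2_eq_square)
  then have D: "2 * real L < real L + s + ?D" by linarith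
  then have pos: "0 < (real L + s + ?D) / (2 * real L)" using L by simp
  have "R_crit L s = 1/2 * ln ((real L + s + ?D) / (2 * real L))"
  proof -
    have "1/2 + s / (2 * real L) + 1/2 * (?D / real L) = (real L + s + ?D) / (2 * real L)"
      using L by (simp add: field_simps)
    then show ?thesis unfolding R_crit_def rt by simp
  qed
  then have "2 * R_crit L s = ln ((real L + s + ?D) / (2 * real L))" by linarith
  then show *: "\<beta> = (real L + s + ?D) / (2 * real L)" by (simp only: \<beta>_def exp_ln [OF pos])
  show "1 < \<beta>" unfolding * using L D by (simp add: field_simps)
qed

text \<open>
  Gallager's quadratic: with \<open>l = 1 + \<rho>\<close>, the stationarity condition in \<open>b\<close> for the exponent below.
  The same equation, solved for \<open>b\<close> when \<open>l = L\<close>, gives the low-rate bound and the critical rate, and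
  solved for \<open>l\<close> when \<open>b = exp (2 * R)\<close>, the high-rate bound.
\<close>

definition gallager_root :: "real \<Rightarrow> real \<Rightarrow> real \<Rightarrow> bool" where
  "gallager_root s l b \<longleftrightarrow> 1 < b \<and> l\<^sup>2 * b\<^sup>2 - l * (l + s) * b + s * (l - 1) = 0"

text \<open>
  Gallager's function \<open>E\<^sub>0(\<rho>)\<close> of the Gaussian channel at \<open>\<rho> = l - 1\<close>, when \<open>b\<close> is the root above.
\<close>

definition gallager_exponent :: "real \<Rightarrow> real \<Rightarrow> real \<Rightarrow> real" where
  "gallager_exponent s l b = 1/2 * ((1 - b) * l + s + ln (b - s / l) + (l - 1) * ln b)"

lemma low_rate_bound_eq:
  fixes s R :: real and L :: nat
  assumes "0 < s" "2 \<le> L"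
  defines "b \<equiv> (real L + s + sqrt ((real L - s)\<^sup>2 + 4 * s)) / (2 * real L)"
  shows "gallager_root s (real L) b"
    and "low_rate_bound L R s = gallager_exponent s (real L) b - (real L - 1) * R"
proof -
  let ?D = "sqrt ((real L - s)\<^sup>2 + 4 * s)"
  have L: "0 < real L" using assms by simp
  have b1: "1 < b" using R_crit_root [OF assms(1,2)] by (simp add: b_def)
  have D: "?D = 2 * real L * b - real L - s" using L by (simp add: b_def)
  have "?D\<^sup>2 = (real L - s)\<^sup>2 + 4 * s" using \<open>0 < s\<close> by simp
  then have "4 * ((real L)\<^sup>2 * b\<^sup>2 - real L * (real L + s) * b + s * (real L - 1)) = 0"
    unfolding D by (simp add: power2_eq_square algebra_simps)
  then show "gallager_root s (real L) b" using b1 by (simp add: gallager_root_def)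
  have "\<bar>real L - s\<bar> < ?D" using \<open>0 < s\<close> by (intro real_less_rsqrt) (simp add: power2_eq_square)
  then have k: "0 < b - s / real L" unfolding D using L by (simp add: field_simps)
  have e1: "real L + s + ?D = 2 * real L * b" and e2: "real L - s + ?D = 2 * real L * (b - s / real L)"
    and e3: "real L + s - ?D = 2 * (real L + s - real L * b)"
    unfolding D using L by (auto simp: algebra_simps)
  show "low_rate_bound L R s = gallager_exponent s (real L) b - (real L - 1) * R"
  proof -
    have "ln (2 * real L * b) = ln (2 * real L) + ln b"
      "ln (2 * real L * (b - s / real L)) = ln (2 * real L) + ln (b - s / real L)"
      using L k b1 by (simp_all add: ln_mult)
    then show ?thesis unfolding low_rate_bound_def e1 e2 e3 gallager_exponent_def
      by (simp only:) (simp add: algebra_simps diff_divide_distrib add_divide_distrib)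
  qed
qed

text \<open>
  For \<open>b = exp (2 * R)\<close> the quadratic is solved for \<open>l\<close>. Written as
  \<open>l * (l * b * (b - 1) - s * (b - 1)) = s\<close>, its left-hand side increases in \<open>l\<close> where the second factor is
  positive, so the location of the positive root \<open>l\<close> can be read off from the values at \<open>1\<close>
  and at \<open>L\<close>: the value at \<open>1\<close> is at most \<open>s\<close> because \<open>R\<close> is below capacity, and the value at \<open>L\<close> is at
  least \<open>s\<close> because \<open>R\<close> is above the critical rate.
\<close>

lemma high_rate_bound_eq:
  fixes s R :: real and L :: nat
  assumes "0 < s" "2 \<le> L" and R: "R_crit L s \<le> R" "R \<le> 1/2 * ln (1 + s)"
  obtains l where "1 \<le> l" "l \<le> real L" "gallager_root s l (exp (2 * R))"
    "high_rate_bound R s = gallager_exponent s l (exp (2 * R)) - (l - 1) * R"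
proof -
  define b where "b = exp (2 * R)"
  define b0 where "b0 = exp (2 * R_crit L s)"
  define Q where "Q = sqrt (1 + 4 * b / (s * (b - 1)))"
  define l where "l = s * (1 + Q) / (2 * b)"
  have L: "0 < real L" "2 \<le> real L" using assms by simp_all
  note b0 = R_crit_root [OF assms(1,2), folded b0_def]
  have "b0 \<le> b" using R(1) by (simp add: b_def b0_def)
  with b0(2) have b1: "1 < b" by simp
  have "b \<le> exp (ln (1 + s))" unfolding b_def using R(2) by (subst exp_le_cancel_iff) simp
  then have bs: "b \<le> 1 + s" using \<open>0 < s\<close> by simp
  have Qpos: "1 < Q" using b1 \<open>0 < s\<close> by (simp add: Q_def)
  have Q2: "s * (b - 1) * (Q\<^sup>2 - 1) = 4 * b"
    using b1 \<open>0 < s\<close> by (simp add: Q_def)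
  have lpos: "0 < l" using b1 Qpos \<open>0 < s\<close> by (simp add: l_def)
  have root: "l\<^sup>2 * b\<^sup>2 - l * (l + s) * b + s * (l - 1) = 0"
  proof -
    have lb: "l * b = s * (1 + Q) / 2" using b1 by (simp add: l_def)
    have "4 * b * (l\<^sup>2 * b\<^sup>2 - l * (l + s) * b + s * (l - 1))
        = 4 * b * (l * b)\<^sup>2 - 4 * (l * b)\<^sup>2 - 4 * s * b * (l * b) + 4 * s * (l * b) - 4 * s * b"
      by (simp add: power2_eq_square algebra_simps)
    also have "\<dots> = s * (s * (b - 1) * (Q\<^sup>2 - 1) - 4 * b)"
      unfolding lb by (simp add: power2_eq_square field_simps)
    finally show ?thesis using Q2 b1 by simp
  qed
  have factored: "(l - 1) * (b * (b - 1) * (l + 1) - s * (b - 1)) = b * (1 + s - b)"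
    using root by (simp add: power2_eq_square algebra_simps)
  have "1 \<le> l"
  proof (rule ccontr)
    assume "\<not> 1 \<le> l"
    have "l * (l * (b * (b - 1)) - s * (b - 1)) = s"
      using root by (simp add: power2_eq_square algebra_simps)
    then have "0 < l * (b * (b - 1)) - s * (b - 1)"
      using lpos \<open>0 < s\<close> by (metis zero_less_mult_pos)
    moreover have "0 < b * (b - 1)" using b1 by simp
    ultimately have "0 < b * (b - 1) * (l + 1) - s * (b - 1)" by (simp add: algebra_simps)
    then have "(l - 1) * (b * (b - 1) * (l + 1) - s * (b - 1)) < 0"
      using \<open>\<not> 1 \<le> l\<close> by (intro mult_neg_pos) auto
    with factored bs b1 show False by (simp add: mult_less_0_iff)
  qed
  have "l \<le> real L"
  proof (rule ccontr)
    assume "\<not> l \<le> real L"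
    then have lL: "real L < l" by simp
    have r0: "(real L)\<^sup>2 * b0\<^sup>2 - real L * (real L + s) * b0 + s * (real L - 1) = 0"
      using low_rate_bound_eq(1) [OF assms(1,2)] unfolding b0(1) gallager_root_def by simp
    \<comment> \<open>\<open>b0\<close> lies to the right of the vertex of the quadratic in \<open>b\<close>, which therefore increases from \<open>b0\<close> to \<open>b\<close>\<close>
    have vertex: "real L + s < 2 * real L * b0" 
    proof -
      have "\<bar>real L - s\<bar> < sqrt ((real L - s)\<^sup>2 + 4 * s)"
        using \<open>0 < s\<close> by (intro real_less_rsqrt) (simp add: power2_eq_square)
      then have "real L + s < real L + s + sqrt ((real L - s)\<^sup>2 + 4 * s)" by linarith
      also have "\<dots> = 2 * real L * b0" unfolding b0(1) using L by simp
      finally show ?thesis .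
    qed
    have "0 \<le> real L * (b - b0) * (real L * b + real L * b0 - (real L + s))"
    proof (intro mult_nonneg_nonneg)
      have "real L * b0 \<le> real L * b" using \<open>b0 \<le> b\<close> by (intro mult_left_mono) auto
      then show "0 \<le> real L * b + real L * b0 - (real L + s)" using vertex by linarith
    qed (use \<open>b0 \<le> b\<close> in auto)
    also have "\<dots> = ((real L)\<^sup>2 * b\<^sup>2 - real L * (real L + s) * b + s * (real L - 1))
        - ((real L)\<^sup>2 * b0\<^sup>2 - real L * (real L + s) * b0 + s * (real L - 1))"
      by (simp add: power2_eq_square algebra_simps)
    finally have "0 \<le> (real L)\<^sup>2 * b\<^sup>2 - real L * (real L + s) * b + s * (real L - 1)"
      unfolding r0 by simp
    then have "s \<le> real L * (real L * (b * (b - 1)) - s * (b - 1))"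
      by (simp add: power2_eq_square algebra_simps)
    moreover have "l * (l * (b * (b - 1)) - s * (b - 1)) = s"
      using root by (simp add: power2_eq_square algebra_simps)
    moreover have "real L * (real L * (b * (b - 1)) - s * (b - 1)) < l * (l * (b * (b - 1)) - s * (b - 1))"
    proof -
      have "0 < real L * (real L * (b * (b - 1)) - s * (b - 1))" using calculation(1) \<open>0 < s\<close> by linarith
      then have p: "0 < real L * (b * (b - 1)) - s * (b - 1)" using L by (simp add: zero_less_mult_iff)
      have "real L * (b * (b - 1)) < l * (b * (b - 1))" using lL b1 by simp
      with p lL L show ?thesis by (intro mult_strict_mono) auto
    qed
    ultimately show False by linarith
  qed
  have ratio: "s / l = 2 * b / (1 + Q)" using \<open>0 < s\<close> Qpos b1 by (simp add: l_def)
  have k: "b - s / l = b - s * (b - 1) / 2 * (Q - 1)"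
  proof -
    have "2 * b / (1 + Q) = s * (b - 1) / 2 * (Q - 1)"
      using Q2 Qpos by (simp add: field_simps power2_eq_square)
    then show ?thesis by (simp add: ratio)
  qed
  have "(1 - b) * l + s = s / (2 * b) * (b + 1 - (b - 1) * Q)"
    using b1 by (simp add: l_def field_simps)
  then have "gallager_exponent s l b - (l - 1) * R
      = 1/2 * ln (b - s * (b - 1) / 2 * (Q - 1)) + s / (4 * b) * (b + 1 - (b - 1) * Q)"
    unfolding gallager_exponent_def k by (simp add: b_def algebra_simps)
  also have "\<dots> = high_rate_bound R s"
    by (simp add: high_rate_bound_def Q_def b_def)
  finally show thesis using \<open>1 \<le> l\<close> \<open>l \<le> real L\<close> root b1
    by (intro that [of l]) (auto simp: gallager_root_def b_def)
qed

text \<open>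
  The first two facts say that the tilt \<open>(1 - k) / (2 * P)\<close> is admissible; the two equations are the
  forms in which the quadratic enters the evaluation of the exponent.
\<close>

lemma gallager_root_tilt:
  fixes s l b :: real
  assumes root: "gallager_root s l b" and "1 \<le> l" "0 < s"
  defines "k \<equiv> b - s / l"
  shows "0 < k" "k \<le> 1" "b + (l - 1) * k = l * b * k" "(l - 1) * s / (l\<^sup>2 * b) = 1 - k"
proof -
  have b: "1 < b" and eq: "l\<^sup>2 * b\<^sup>2 - l * (l + s) * b + s * (l - 1) = 0"
    using root by (auto simp: gallager_root_def)
  have sl: "s = l * (b - k)" using assms(2) by (simp add: k_def)
  have "l * (l * b * k - (b + (l - 1) * k)) = 0"
    using eq unfolding sl by (simp add: power2_eq_square algebra_simps)
  then show *: "b + (l - 1) * k = l * b * k" using assms(2) by simp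
  then have "b = k * (l * (b - 1) + 1)" by (simp add: algebra_simps)
  moreover have "0 < l * (b - 1) + 1" using b assms(2) by (simp add: add_nonneg_pos)
  ultimately show "0 < k" using b by (metis less_trans zero_less_mult_pos2 zero_less_one)
  have "(l - 1) * (b - k) = (1 - k) * (l * b)"
    using * by (simp add: algebra_simps)
  then show r: "(l - 1) * s / (l\<^sup>2 * b) = 1 - k"
    unfolding sl using assms(2) b by (simp add: power2_eq_square divide_eq_eq mult_ac)
  have "0 \<le> (l - 1) * s / (l\<^sup>2 * b)" using assms(2,3) b by simp
  then show "k \<le> 1" unfolding r by simp
qed

text \<open>
  With this tilt, half the remaining precision is \<open>k / (2 * P)\<close> and adding \<open>\<kappa>\<close> gives \<open>b / (2 * P)\<close>; the
  quadratic then reduces the logarithm of the noise integral to \<open>ln k\<close> and the last summand to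
  \<open>(1 - k) / 2\<close>.
\<close>

lemma shell_exponent_optimal_tilt:
  fixes P \<sigma> s l b :: real
  assumes "0 < P" "0 < \<sigma>" and s: "s = P / \<sigma>\<^sup>2" and root: "gallager_root s l b" and "1 \<le> l"
  shows "shell_exponent \<sigma> (l - 1) ((1 - (b - s / l)) / (2 * P)) P P = gallager_exponent s l b"
proof -
  define k where "k = b - s / l"
  define \<kappa> where "\<kappa> = 1 / (2 * \<sigma>\<^sup>2 * l)"
  have "0 < s" using assms by simp
  note tilt = gallager_root_tilt [OF root \<open>1 \<le> l\<close> \<open>0 < s\<close>, folded k_def]
  have b: "1 < b" using root by (simp add: gallager_root_def)
  have \<kappa>: "0 < \<kappa>" using assms by (simp add: \<kappa>_def)
  have Ps: "P = s * \<sigma>\<^sup>2" using assms by simp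
  have \<alpha>: "1 / (2 * P) - (1 - k) / (2 * P) = k / (2 * P)"
    by (simp add: diff_divide_distrib)
  have \<kappa>P: "\<kappa> = (s / l) / (2 * P)" unfolding Ps \<kappa>_def using \<open>0 < s\<close> by simp
  have \<alpha>\<kappa>: "k / (2 * P) + \<kappa> = b / (2 * P)" unfolding \<kappa>P add_divide_distrib [symmetric] by (simp add: k_def)
  have bb: "(l - 1) * (k / (2 * P) * \<kappa> / (b / (2 * P))) = \<kappa> * ((l - 1) * k / b)"
    using assms(1) b by simp
  have sum: "\<kappa> + \<kappa> * ((l - 1) * k / b) = \<kappa> * (l * k)"
  proof -
    have "\<kappa> + \<kappa> * ((l - 1) * k / b) = \<kappa> * ((b + (l - 1) * k) / b)"
      using b by (simp add: add_divide_distrib distrib_left)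
    also have "(b + (l - 1) * k) / b = l * k" unfolding tilt(3) using b by simp
    finally show ?thesis .
  qed
  have noise: "2 * \<sigma>\<^sup>2 * (\<kappa> * (l * k)) = k" using assms by (simp add: \<kappa>_def)
  have last: "\<kappa> * (\<kappa> * ((l - 1) * k / b)) / (\<kappa> * (l * k)) * P = (1 - k) / 2"
  proof -
    have "\<kappa> * (\<kappa> * ((l - 1) * k / b)) / (\<kappa> * (l * k)) * P = (\<kappa> * P) * (l - 1) / (l * b)"
      using \<kappa> tilt(1) by (simp add: mult_ac)
    also have "\<kappa> * P = s / l / 2" unfolding \<kappa>P using assms(1) by simp
    also have "s / l / 2 * (l - 1) / (l * b) = ((l - 1) * s / (l\<^sup>2 * b)) / 2"
      by (simp add: power2_eq_square mult_ac)
    finally show ?thesis unfolding tilt(4) .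
  qed
  have "shell_exponent \<sigma> (l - 1) ((1 - k) / (2 * P)) P P
      = (l - 1) * ((1 - k) / (2 * P)) * P + (l - 1) / 2 * ln (2 * P * (b / (2 * P))) + 1/2 * ln k + (1 - k) / 2"
    unfolding shell_exponent_def Let_def add_diff_cancel_left' diff_add_cancel add.commute [of 1 "l - 1"]
      \<kappa>_def [symmetric] \<alpha> \<alpha>\<kappa> bb sum noise last ..
  also have "\<dots> = l * (1 - k) / 2 + (l - 1) / 2 * ln b + 1/2 * ln k"
    using assms(1) by (simp add: field_simps)
  also have "l * (1 - k) = (1 - b) * l + s"
    using assms(5) by (simp add: k_def field_simps)
  finally show ?thesis unfolding gallager_exponent_def k_def [symmetric] by (simp add: algebra_simps add_divide_distrib diff_divide_distrib)
qed

lemma shell_exponent_continuous: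
  assumes "0 < P" "0 < \<sigma>" "0 \<le> \<rho>" "r \<le> 1 / (2 * P)"
  shows "((\<lambda>\<epsilon>. shell_exponent \<sigma> \<rho> r (P - \<epsilon>) (P - 2 * \<epsilon>)) \<longlongrightarrow> shell_exponent \<sigma> \<rho> r P P) (at_right 0)"
proof -
  define \<kappa> where "\<kappa> = 1 / (2 * \<sigma>\<^sup>2 * (1 + \<rho>))"
  define \<alpha> where "\<alpha> = 1 / (2 * P) - r"
  have \<kappa>: "0 < \<kappa>" and \<alpha>: "0 \<le> \<alpha>" using assms by (simp_all add: \<kappa>_def \<alpha>_def)
  have sum: "0 < \<alpha> + \<kappa>" "0 < \<kappa> + \<rho> * (\<alpha> * \<kappa> / (\<alpha> + \<kappa>))"
    using \<kappa> \<alpha> assms(3) by (auto intro!: add_pos_nonneg)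
  have v: "((\<lambda>\<epsilon>. P - \<epsilon>) \<longlongrightarrow> P) (at_right 0)" "((\<lambda>\<epsilon>. P - 2 * \<epsilon>) \<longlongrightarrow> P) (at_right 0)"
    by (auto intro!: tendsto_eq_intros)
  have a: "((\<lambda>\<epsilon>. 1 / (2 * (P - \<epsilon>)) - r) \<longlongrightarrow> \<alpha>) (at_right 0)"
    unfolding \<alpha>_def using assms(1) by (intro tendsto_intros v) auto
  have b: "((\<lambda>\<epsilon>. \<rho> * ((1 / (2 * (P - \<epsilon>)) - r) * \<kappa> / ((1 / (2 * (P - \<epsilon>)) - r) + \<kappa>)))
      \<longlongrightarrow> \<rho> * (\<alpha> * \<kappa> / (\<alpha> + \<kappa>))) (at_right 0)"
    using sum by (intro tendsto_intros a) auto
  show ?thesis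
    unfolding shell_exponent_def Let_def \<kappa>_def [symmetric]
    unfolding \<alpha>_def [symmetric]
    using sum assms by (intro tendsto_add tendsto_mult tendsto_divide tendsto_ln tendsto_const v a b) auto
qed

section \<open>Sequences of codes\<close>

text \<open>
  The summand \<open>l\<close> guarantees more than \<open>l\<close> codewords even at rate \<open>0\<close>, so that list errors occur.
\<close>

definition codebook_size :: "real \<Rightarrow> nat \<Rightarrow> nat \<Rightarrow> nat" where
  "codebook_size R l n = nat \<lceil>exp (real n * R)\<rceil> + l"

lemma codebook_size_gt: "l < codebook_size R l n"
  by (simp add: codebook_size_def)

lemma codebook_size_bounds:
  assumes "0 \<le> R"
  shows "exp (real n * R) \<le> real (codebook_size R l n)"
    and "real (codebook_size R l n) \<le> (2 + real l) * exp (real n * R)"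
proof -
  have exp1: "1 \<le> exp (real n * R)" using assms by simp
  have "real (nat \<lceil>exp (real n * R)\<rceil>) \<le> exp (real n * R) + 1" using exp1 by linarith
  moreover have "1 + real l \<le> (1 + real l) * exp (real n * R)"
    using exp1 mult_left_mono [of 1 "exp (real n * R)" "1 + real l"] by simp
  ultimately show "real (codebook_size R l n) \<le> (2 + real l) * exp (real n * R)"
    by (simp add: codebook_size_def algebra_simps)
  show "exp (real n * R) \<le> real (codebook_size R l n)"
    unfolding codebook_size_def by linarith
qed

text \<open>
  The power constraint bounds the norm from above while the exponent needs it bounded from below near
  \<open>n * P\<close>; so the inputs are Gaussian of variance \<open>P - \<epsilon>\<close>, conditioned on a squared norm between
  \<open>n * (P - 2 * \<epsilon>)\<close> and \<open>n * P\<close>. By continuity the loss in the exponent vanishes with \<open>\<epsilon>\<close>.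
\<close>

lemma random_code_rate_eventually:
  fixes P \<sigma> \<rho> r R T :: real
  assumes "0 < P" "0 < \<sigma>" "0 \<le> \<rho>" "\<rho> \<le> real l" "0 \<le> r" "r \<le> 1 / (2 * P)" "0 \<le> R"
    and T: "T < shell_exponent \<sigma> \<rho> r P P - \<rho> * R"
  shows "\<forall>\<^sub>F n in sequentially. \<exists>C. awgn_code P n C \<and> card C = codebook_size R l n \<and>
    0 < ml_list_error_avg n \<sigma> l C \<and> T \<le> - (1 / real n) * ln (ml_list_error_avg n \<sigma> l C)"
proof -
  have "((\<lambda>\<epsilon>. shell_exponent \<sigma> \<rho> r (P - \<epsilon>) (P - 2 * \<epsilon>) - \<rho> * R) \<longlongrightarrow> shell_exponent \<sigma> \<rho> r P P - \<rho> * R) (at_right 0)"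
    by (intro tendsto_intros shell_exponent_continuous assms)
  then have "\<forall>\<^sub>F \<epsilon> in at_right 0. T < shell_exponent \<sigma> \<rho> r (P - \<epsilon>) (P - 2 * \<epsilon>) - \<rho> * R"
    using T by (rule order_tendstoD)
  moreover have "\<forall>\<^sub>F \<epsilon> in at_right 0. \<epsilon> \<in> {0<..<P}" using assms(1) by (rule eventually_at_right_real)
  ultimately have "\<forall>\<^sub>F \<epsilon> in at_right 0. \<epsilon> \<in> {0<..<P} \<and> T < shell_exponent \<sigma> \<rho> r (P - \<epsilon>) (P - 2 * \<epsilon>) - \<rho> * R"
    by eventually_elim simp
  from eventually_happens' [OF trivial_limit_at_right_real this]
  obtain \<epsilon> where \<epsilon>: "0 < \<epsilon>" "\<epsilon> < P" and gap: "T < shell_exponent \<sigma> \<rho> r (P - \<epsilon>) (P - 2 * \<epsilon>) - \<rho> * R"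
    by auto
  define E where "E = shell_exponent \<sigma> \<rho> r (P - \<epsilon>) (P - 2 * \<epsilon>)"
  define \<tau> where "\<tau> = sqrt (P - \<epsilon>)"
  have \<tau>: "0 < \<tau>" "\<tau>\<^sup>2 = P - \<epsilon>" using \<epsilon> by (auto simp: \<tau>_def)
  have r: "r \<le> 1 / (2 * \<tau>\<^sup>2)"
  proof -
    have "1 / (2 * P) \<le> 1 / (2 * (P - \<epsilon>))" using \<epsilon> by (intro divide_left_mono) auto
    then show ?thesis using assms(6) \<tau>(2) by simp
  qed
  define K where "K = ln 2 + \<rho> * ln (2 * (2 + real l))"
  have "(\<lambda>n. K / real n) \<longlonglongrightarrow> 0" by (rule lim_const_over_n)
  then have small: "\<forall>\<^sub>F n in sequentially. K / real n < E - \<rho> * R - T"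
    using gap by (intro order_tendstoD) (auto simp: E_def)
  show ?thesis
    using gaussian_norm_concentration [OF \<tau>(1) \<epsilon>(1)] small eventually_gt_at_top [of 0]
  proof eventually_elim
    case (elim n)
    define M where "M = codebook_size R l n"
    note M_bounds = codebook_size_bounds [OF assms(7), where n = n and l = l, folded M_def]
    have M: "l < M" "0 < M" using codebook_size_gt [of l R n] by (auto simp: M_def)
    have mass: "1/2 \<le> measure (awgn_noise n \<tau>)
      {x \<in> space (awgn_noise n \<tau>). real n * (P - 2 * \<epsilon>) \<le> sqnorm n x \<and> sqnorm n x \<le> real n * P}"
      using elim(1) unfolding \<tau>(2) by simp
    obtain C where C: "awgn_code P n C" "card C = M"
      and err: "ml_list_error_avg n \<sigma> l C \<le> 2 * ((2 * real M) powr \<rho> * exp (- real n * shell_exponent \<sigma> \<rho> r (\<tau>\<^sup>2) (P - 2 * \<epsilon>)))"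
      using shell_code_exists [OF assms(2) \<tau>(1) assms(3,4,5) r M(2) elim(3) mass] by blast
    have pos: "0 < ml_list_error_avg n \<sigma> l C"
      using ml_list_error_avg_pos [OF assms(2) C(1)] C(2) M(1) by simp
    have "ln (ml_list_error_avg n \<sigma> l C) \<le> ln (2 * ((2 * real M) powr \<rho> * exp (- real n * E)))"
      using err pos unfolding \<tau>(2) E_def [symmetric] by (intro ln_mono) auto
    also have "\<dots> = ln 2 + \<rho> * ln (2 * real M) - real n * E"
      using M by (simp add: ln_mult ln_powr)
    also have "\<dots> \<le> K + \<rho> * (real n * R) - real n * E"
    proof -
      have "ln (2 * real M) \<le> ln (2 * (2 + real l) * exp (real n * R))"
        using M M_bounds(2) by (intro ln_mono) (auto simp: algebra_simps)
      also have "\<dots> = ln (2 * (2 + real l)) + real n * R"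
        by (subst ln_mult) (auto simp: add_nonneg_pos)
      finally have "\<rho> * ln (2 * real M) \<le> \<rho> * (ln (2 * (2 + real l)) + real n * R)"
        using assms(3) by (rule mult_left_mono)
      then show ?thesis by (simp add: K_def distrib_left)
    qed
    finally have "(1 / real n) * ln (ml_list_error_avg n \<sigma> l C) \<le> (1 / real n) * (K + \<rho> * (real n * R) - real n * E)"
      by (intro mult_left_mono) auto
    also have "\<dots> = K / real n + \<rho> * R - E"
      using elim(3) by (simp add: field_simps)
    finally have "T \<le> - (1 / real n) * ln (ml_list_error_avg n \<sigma> l C)" using elim(2) by simp
    then show ?case using C pos by (auto simp: M_def)
  qed
qed

lemma rate_tendsto:
  assumes "0 \<le> R"
  shows "(\<lambda>n. ln (real (codebook_size R l n)) / real n) \<longlonglongrightarrow> R"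
proof (rule tendsto_sandwich [where f = "\<lambda>_. R" and h = "\<lambda>n. R + ln (2 + real l) / real n"])
  note M = codebook_size_bounds [OF assms, where l = l]
  have lower: "real n * R \<le> ln (real (codebook_size R l n))" for n
  proof -
    have "ln (exp (real n * R)) \<le> ln (real (codebook_size R l n))"
      by (intro ln_mono M(1) exp_gt_zero)
    then show ?thesis by simp
  qed
  have upper: "ln (real (codebook_size R l n)) \<le> ln (2 + real l) + real n * R" for n
  proof -
    have "ln (real (codebook_size R l n)) \<le> ln ((2 + real l) * exp (real n * R))"
      by (intro ln_mono M(2)) (rule less_le_trans [OF exp_gt_zero M(1)])
    also have "\<dots> = ln (2 + real l) + real n * R" by (subst ln_mult) (auto simp: add_nonneg_pos)
    finally show ?thesis .
  qed
  show "\<forall>\<^sub>F n in sequentially. R \<le> ln (real (codebook_size R l n)) / real n"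
    using eventually_gt_at_top [of 0]
    by eventually_elim (use lower in \<open>simp add: pos_le_divide_eq mult.commute\<close>)
  show "\<forall>\<^sub>F n in sequentially. ln (real (codebook_size R l n)) / real n \<le> R + ln (2 + real l) / real n"
    using eventually_gt_at_top [of 0]
  proof eventually_elim
    case (elim n)
    have "ln (real (codebook_size R l n)) / real n \<le> (ln (2 + real l) + real n * R) / real n"
      by (intro divide_right_mono upper) simp
    also have "\<dots> = R + ln (2 + real l) / real n" using elim by (simp add: add_divide_distrib)
    finally show ?case .
  qed
  show "(\<lambda>n. R + ln (2 + real l) / real n) \<longlonglongrightarrow> R"
    by (rule tendsto_eq_intros lim_const_over_n refl | simp)+
qed simp

text \<open>
  A diagonal choice of blocklengths lets the gap to \<open>E\<^sub>0\<close> shrink to \<open>0\<close>; compactness of the extended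
  reals then provides a subsequence along which the exponent has a limit.
\<close>

lemma codes_with_exponent:
  fixes P \<sigma> R E\<^sub>0 :: real
  assumes "0 \<le> R"
    and codes: "\<And>T. T < E\<^sub>0 \<Longrightarrow> \<forall>\<^sub>F n in sequentially. \<exists>C. awgn_code P n C \<and>
      card C = codebook_size R l n \<and>
      0 < ml_list_error_avg n \<sigma> l C \<and> T \<le> - (1 / real n) * ln (ml_list_error_avg n \<sigma> l C)"
  shows "\<exists>n C E. codes_of_rate P R n C \<and> has_list_error_exponent \<sigma> l n C E \<and> ereal E\<^sub>0 \<le> E"
proof -
  let ?e = "\<lambda>n C. - (1 / real n) * ln (ml_list_error_avg n \<sigma> l C)"
  let ?good = "\<lambda>k n C. 0 < n \<and> awgn_code P n C \<and> card C = codebook_size R l n \<and>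
      0 < ml_list_error_avg n \<sigma> l C \<and> E\<^sub>0 - 1 / real (Suc k) \<le> ?e n C"
  have ex: "\<exists>n C. m < n \<and> ?good k n C" for k m
  proof -
    have "\<forall>\<^sub>F n in sequentially. m < n \<and> (\<exists>C. awgn_code P n C \<and> card C = codebook_size R l n \<and>
      0 < ml_list_error_avg n \<sigma> l C \<and> E\<^sub>0 - 1 / real (Suc k) \<le> ?e n C)"
      using eventually_gt_at_top [of m] codes [of "E\<^sub>0 - 1 / real (Suc k)"] by (simp add: eventually_conj)
    from eventually_happens [OF this] obtain n C where "m < n" "awgn_code P n C"
      "card C = codebook_size R l n" "0 < ml_list_error_avg n \<sigma> l C" "E\<^sub>0 - 1 / real (Suc k) \<le> ?e n C"
      by auto
    then show ?thesis by (intro exI [of _ n] exI [of _ C]) simp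
  qed
  have "\<exists>f. \<forall>k. ?good k (fst (f k)) (snd (f k)) \<and> fst (f k) < fst (f (Suc k))"
  proof (rule dependent_nat_choice)
    show "\<exists>x. ?good 0 (fst x) (snd x)" using ex [of 0 0] by auto
    show "\<exists>y. ?good (Suc k) (fst y) (snd y) \<and> fst x < fst y" for x k
      using ex [of "fst x" "Suc k"] by auto
  qed
  then obtain f where f: "\<And>k. ?good k (fst (f k)) (snd (f k))" and inc: "\<And>k. fst (f k) < fst (f (Suc k))"
    by blast
  define n where "n k = fst (f k)" for k
  define C where "C k = snd (f k)" for k
  have good: "?good k (n k) (C k)" for k using f [of k] unfolding n_def C_def .
  have mono: "strict_mono n" using inc by (simp add: strict_mono_Suc_iff n_def)
  obtain E s where s: "strict_mono (s :: nat \<Rightarrow> nat)" and lim: "((\<lambda>k. ereal (?e (n k) (C k))) \<circ> s) \<longlonglongrightarrow> E"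
    using compact_complete_linorder by blast
  have "ereal E\<^sub>0 \<le> E"
  proof (rule LIMSEQ_le [OF _ lim])
    have "(\<lambda>k. E\<^sub>0 - 1 / real (Suc k)) \<longlonglongrightarrow> E\<^sub>0 - 0"
      by (intro tendsto_diff tendsto_const LIMSEQ_Suc [OF lim_const_over_n, of 1])
    then have "(\<lambda>k. ereal (E\<^sub>0 - 1 / real (Suc k))) \<longlonglongrightarrow> ereal E\<^sub>0" by simp
    then show "(\<lambda>k. ereal (E\<^sub>0 - 1 / real (Suc (s k)))) \<longlonglongrightarrow> ereal E\<^sub>0"
      using LIMSEQ_subseq_LIMSEQ [OF _ s] by (simp add: o_def)
    show "\<exists>N. \<forall>k\<ge>N. ereal (E\<^sub>0 - 1 / real (Suc (s k))) \<le> ((\<lambda>k. ereal (?e (n k) (C k))) \<circ> s) k"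
      using good by auto
  qed
  moreover have mono': "strict_mono (n \<circ> s)" using mono s by (rule strict_mono_o)
  moreover have "(\<lambda>k. code_rate ((n \<circ> s) k) ((C \<circ> s) k)) \<longlonglongrightarrow> R"
    using LIMSEQ_subseq_LIMSEQ [OF rate_tendsto [OF assms(1), of l] mono'] good
    by (simp add: o_def code_rate_def)
  ultimately show ?thesis
    using good lim unfolding codes_of_rate_def has_list_error_exponent_def
    by (intro exI [of _ "n \<circ> s"] exI [of _ "C \<circ> s"] exI [of _ E]) (auto simp: o_def)
qed

theorem mainTheorem4:
  fixes P \<sigma> snr R :: real and L :: nat
  assumes "P > 0" and "\<sigma> > 0" and "L \<ge> 2"
    and "snr = P / \<sigma>\<^sup>2"
    and "0 \<le> R" and "R \<le> 1/2 * ln (1 + snr)"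
  shows "\<exists>(n :: nat \<Rightarrow> nat) (C :: nat \<Rightarrow> (nat \<Rightarrow> real) set) (E :: ereal).
           codes_of_rate P R n C \<and>
           has_list_error_exponent \<sigma> (L - 1) n C E \<and>
           (R_crit L snr \<le> R \<longrightarrow> E \<ge> ereal (high_rate_bound R snr)) \<and>
           (R \<le> R_crit L snr \<longrightarrow> E \<ge> ereal (low_rate_bound L R snr))"
proof -
  have snr: "0 < snr" using assms by simp
  have achieve: "\<exists>n C E. codes_of_rate P R n C \<and> has_list_error_exponent \<sigma> (L - 1) n C E
      \<and> ereal (gallager_exponent snr l b - (l - 1) * R) \<le> E"
    if l: "1 \<le> l" "l \<le> real L" and root: "gallager_root snr l b" for l b
  proof (rule codes_with_exponent [OF \<open>0 \<le> R\<close>])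
    fix T assume T: "T < gallager_exponent snr l b - (l - 1) * R"
    define r where "r = (1 - (b - snr / l)) / (2 * P)"
    note tilt = gallager_root_tilt [OF root l(1) snr]
    have r: "0 \<le> r" "r \<le> 1 / (2 * P)"
      unfolding r_def using tilt(1,2) \<open>P > 0\<close> by (auto intro!: divide_right_mono)
    have "T < shell_exponent \<sigma> (l - 1) r P P - (l - 1) * R"
      using T shell_exponent_optimal_tilt [OF assms(1,2,4) root l(1)] by (simp add: r_def)
    moreover have "l - 1 \<le> real (L - 1)" using l \<open>L \<ge> 2\<close> by simp
    ultimately show "\<forall>\<^sub>F n in sequentially. \<exists>C. awgn_code P n C \<and>
        card C = codebook_size R (L - 1) n \<and>
        0 < ml_list_error_avg n \<sigma> (L - 1) C \<and> T \<le> - (1 / real n) * ln (ml_list_error_avg n \<sigma> (L - 1) C)"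
      using l(1) by (intro random_code_rate_eventually [OF assms(1,2) _ _ r assms(5)]) auto
  qed
  let ?lb = "(real L + snr + sqrt ((real L - snr)\<^sup>2 + 4 * snr)) / (2 * real L)"
  obtain nl Cl El where low: "codes_of_rate P R nl Cl" "has_list_error_exponent \<sigma> (L - 1) nl Cl El"
    "ereal (low_rate_bound L R snr) \<le> El"
    using achieve [of "real L" ?lb] low_rate_bound_eq [OF snr \<open>L \<ge> 2\<close>] \<open>L \<ge> 2\<close> by auto
  \<comment> \<open>at the critical rate both bounds apply, so the code for the larger one is taken\<close>
  show ?thesis
  proof (cases "R_crit L snr \<le> R \<and> low_rate_bound L R snr \<le> high_rate_bound R snr")
    case True
    obtain l where l: "1 \<le> l" "l \<le> real L" "gallager_root snr l (exp (2 * R))"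
      "high_rate_bound R snr = gallager_exponent snr l (exp (2 * R)) - (l - 1) * R"
      using high_rate_bound_eq [OF snr \<open>L \<ge> 2\<close> _ assms(6)] True by blast
    then obtain n C E where "codes_of_rate P R n C" "has_list_error_exponent \<sigma> (L - 1) n C E"
      and E: "ereal (high_rate_bound R snr) \<le> E"
      using achieve [of l "exp (2 * R)"] by auto
    moreover have "ereal (low_rate_bound L R snr) \<le> E"
      using True E by (meson ereal_less_eq(3) order_trans)
    ultimately show ?thesis by blast
  next
    case False
    then have "R_crit L snr \<le> R \<longrightarrow> ereal (high_rate_bound R snr) \<le> El"
      using low(3) by (meson ereal_less_eq(3) linear order_trans)
    with low show ?thesis by blast
  qed
qed

end
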